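(* Let $(M,g)$ be an $n$-dimensional $(N(k),\xi)$-semi-Riemannian manifold, let $a_0,\dots,a_7$ be real numbers, let $\ell\ge 0$ be an integer, and suppose $M$ is $(R,\mathcal{T}_a,S^\ell)$-pseudosymmetric, i.e. $R\cdot\mathcal{T}_a=L_{S^\ell}\,Q(S^\ell,\mathcal{T}_a)$ holds on $\mathcal{U}_{S^\ell}=\{x\in M:Q(S^\ell,\mathcal{T}_a)\neq 0\text{ at }x\}$ for some smooth function $L_{S^\ell}$ on $\mathcal{U}_{S^\ell}$. Then (on $\mathcal{U}_{S^\ell}$), for all vector fields $X,V,W$: \begin{align*} &k(a_1+a_3+a_5)\big(S(X,V)-k(n-1)g(X,V)\big)\eta(W)+k(a_1+a_2+a_6)\big(S(X,W)-k(n-1)g(X,W)\big)\eta(V)\\ =\;&L_{S^\ell}\Big(-(ka_0+k(n-1)(a_1+a_3+a_4+a_5+a_6)+a_7r)S^\ell(X,V)\eta(W)\\ &+k^\ell(n-1)^\ell(ka_0+k(n-1)(a_4+a_6)+a_7r)g(X,V)\eta(W)\\ &+k^{\ell+1}(n-1)^{\ell+1}(a_4+a_5)g(X,W)\eta(V)-k(n-1)(a_1+a_2+a_4+a_5+a_6)S^\ell(X,W)\eta(V)\\ &+a_5S^{\ell+1}(X,V)\eta(W)+a_6S^{\ell+1}(X,W)\eta(V)\\ &+k^\ell(n-1)^\ell(a_1+a_3)S(X,V)\eta(W)+k^\ell(n-1)^\ell(a_1+a_2)S(X,W)\eta(V)\Big). \end{align*}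
   Context: $(M,g)$ is an $n$-dimensional semi-Riemannian manifold; $R$ is its curvature tensor (sign convention: constant curvature $c$ means $R(X,Y)Z=c(g(Y,Z)X-g(X,Z)Y)$), $S(Y,Z)=\mathrm{tr}(X\mapsto R(X,Y)Z)$ the Ricci tensor, $Q$ the Ricci operator ($g(QX,Y)=S(X,Y)$), $r$ the scalar curvature. $S^\ell(X,Y)=g(Q^\ell X,Y)$ for $\ell=0,1,2,\dots$, so $S^0=g$, $S^1=S$; $k^0(n-1)^0=1$. $(N(k),\xi)$-semi-Riemannian manifold: $k$ is a real number and $\xi$ is a vector field with $g(\xi,\xi)=\varepsilon\in\{1,-1\}$ lying in the $k$-nullity distribution, i.e. $R(X,Y)\xi=k(g(Y,\xi)X-g(X,\xi)Y)$ for all $X,Y$; $\eta(X)=\varepsilon g(X,\xi)$. For real $a_0,\dots,a_7$, $\mathcal{T}_a(X,Y)Z=a_0R(X,Y)Z+a_1S(Y,Z)X+a_2S(X,Z)Y+a_3S(X,Y)Z+a_4g(Y,Z)QX+a_5g(X,Z)QY+a_6g(X,Y)QZ+a_7r(g(Y,Z)X-g(X,Z)Y)$. For the $(1,3)$ tensor $\mathcal{T}_a$ and an endomorphism $F$: $(F\cdot\mathcal{T}_a)(U,V)W=F(\mathcal{T}_a(U,V)W)-\mathcal{T}_a(FU,V)W-\mathcal{T}_a(U,FV)W-\mathcal{T}_a(U,V)FW$. $R\cdot\mathcal{T}_a$ is the tensor $(U,V,W;Z,X)\mapsto(R(Z,X)\cdot\mathcal{T}_a)(U,V)W$, and, for a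 $(0,2)$ tensor $\sigma$, $Q(\sigma,\mathcal{T}_a)(U,V,W;Z,X)=((Z\wedge_\sigma X)\cdot\mathcal{T}_a)(U,V)W$ with $(Z\wedge_\sigma X)Y=\sigma(X,Y)Z-\sigma(Z,Y)X$. *)

theory Defs
  imports "HOL-Analysis.Analysis"
begin

section \<open>Smooth manifolds\<close>

text \<open>
  Differentiability of class \<open>C^k\<close>. The definition is meant for \<^emph>\<open>open\<close> \<open>S\<close> in a
  finite-dimensional space, where it says that all iterated directional derivatives up to
  order \<open>k\<close> exist (as Frechet derivatives) and are continuous.
\<close>

primrec Ck_on :: "nat \<Rightarrow> 'a::real_normed_vector set \<Rightarrow> ('a \<Rightarrow> 'b::real_normed_vector) \<Rightarrow> bool" where
  "Ck_on 0 S f \<longleftrightarrow> continuous_on S f"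
| "Ck_on (Suc k) S f \<longleftrightarrow>
     (\<forall>x\<in>S. f differentiable (at x)) \<and> (\<forall>v. Ck_on k S (\<lambda>x. frechet_derivative f (at x) v))"

definition smooth_on :: "'a::real_normed_vector set \<Rightarrow> ('a \<Rightarrow> 'b::real_normed_vector) \<Rightarrow> bool" where
  "smooth_on S f \<longleftrightarrow> (\<forall>k. Ck_on k S f)"

text \<open>A chart is a pair of a domain in \<open>M\<close> and a coordinate map on it.\<close>

type_synonym ('m, 'n) chart = "'m set \<times> ('m \<Rightarrow> real ^ 'n)"

abbreviation cdom :: "('m, 'n) chart \<Rightarrow> 'm set" where
  "cdom c \<equiv> fst c"

abbreviation coord :: "('m, 'n) chart \<Rightarrow> 'm \<Rightarrow> real ^ 'n" where
  "coord c \<equiv> snd c"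

definition cinv :: "('m, 'n) chart \<Rightarrow> real ^ 'n \<Rightarrow> 'm" where
  "cinv c = inv_into (cdom c) (coord c)"

text \<open>
  The manifold \<open>M\<close> is a Hausdorff, second countable topological space (the type \<open>'m\<close>) with
  a smooth atlas \<open>A\<close> modelled on \<open>real ^ 'n\<close>; its dimension is \<open>CARD('n)\<close>.
\<close>

definition smooth_atlas ::
    "('m::{t2_space,second_countable_topology}, 'n::finite) chart set \<Rightarrow> bool" where
  "smooth_atlas A \<longleftrightarrow>
     (\<forall>c\<in>A. open (cdom c) \<and> open (coord c ` cdom c) \<and>
        homeomorphism (cdom c) (coord c ` cdom c) (coord c) (cinv c)) \<and>
     (\<Union>c\<in>A. cdom c) = UNIV \<and>
     (\<forall>c\<in>A. \<forall>d\<in>A. smooth_on (coord c ` (cdom c \<inter> cdom d)) (coord d \<circ> cinv c))"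

definition smooth_fun_on ::
    "('m, 'n::finite) chart set \<Rightarrow> 'm set \<Rightarrow> ('m \<Rightarrow> 'b::real_normed_vector) \<Rightarrow> bool" where
  "smooth_fun_on A U f \<longleftrightarrow> (\<forall>c\<in>A. smooth_on (coord c ` (cdom c \<inter> U)) (f \<circ> cinv c))"

section \<open>Tangent vectors\<close>

text \<open>
  A tangent vector at \<open>p\<close> is the family of its coordinate representations in all charts around
  \<open>p\<close>, any two of them being related by the differential of the transition map. The type
  \<open>tvec\<close> contains all families \<open>chart \<Rightarrow> real ^ 'n\<close>; the tangent spaces are linear
  subspaces of it. Components in charts that are not charts of the atlas around \<open>p\<close> are
  required to be 0, so that a tangent vector is determined by its meaningful components.
\<close>

typedef ('m, 'n::finite) tvec = "UNIV :: (('m, 'n) chart \<Rightarrow> real ^ 'n) set"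
  morphisms comp TV ..

instantiation tvec :: (type, finite) real_vector
begin

definition "0 = TV (\<lambda>c. 0)"
definition "u + v = TV (\<lambda>c. comp u c + comp v c)"
definition "u - v = TV (\<lambda>c. comp u c - comp v c)"
definition "- v = TV (\<lambda>c. - comp v c)"
definition "t *\<^sub>R v = TV (\<lambda>c. t *\<^sub>R comp v c)"

instance
  by standard
    (simp_all add: zero_tvec_def plus_tvec_def minus_tvec_def uminus_tvec_def scaleR_tvec_def
      TV_inverse comp_inverse comp_inject[symmetric] algebra_simps)

end

definition tangent_space ::
    "('m, 'n::finite) chart set \<Rightarrow> 'm \<Rightarrow> ('m, 'n) tvec set" where
  "tangent_space A p =
     {v. (\<forall>c. \<not> (c \<in> A \<and> p \<in> cdom c) \<longrightarrow> comp v c = 0) \<and>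
         (\<forall>c\<in>A. \<forall>d\<in>A. p \<in> cdom c \<and> p \<in> cdom d \<longrightarrow>
            comp v d = frechet_derivative (coord d \<circ> cinv c) (at (coord c p)) (comp v c))}"

text \<open>The tangent vector at \<open>p\<close> with coordinates \<open>u\<close> in the chart \<open>c\<close>.\<close>

definition tv ::
    "('m, 'n::finite) chart set \<Rightarrow> ('m, 'n) chart \<Rightarrow> 'm \<Rightarrow> real ^ 'n \<Rightarrow> ('m, 'n) tvec" where
  "tv A c p u = TV (\<lambda>d. if d \<in> A \<and> p \<in> cdom d
      then frechet_derivative (coord d \<circ> cinv c) (at (coord c p)) u else 0)"

definition smooth_vector_field ::
    "('m, 'n::finite) chart set \<Rightarrow> ('m \<Rightarrow> ('m, 'n) tvec) \<Rightarrow> bool" where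
  "smooth_vector_field A X \<longleftrightarrow>
     (\<forall>p. X p \<in> tangent_space A p) \<and>
     (\<forall>c\<in>A. smooth_on (coord c ` cdom c) (\<lambda>x. comp (X (cinv c x)) c))"

text \<open>
  Trace of an endomorphism \<open>F\<close> of a finite-dimensional subspace \<open>V\<close>; it does not depend on
  the chosen basis.
\<close>

definition trace_on :: "'a::real_vector set \<Rightarrow> ('a \<Rightarrow> 'a) \<Rightarrow> real" where
  "trace_on V F =
     (let B = (SOME B. independent B \<and> span B = V) in \<Sum>b\<in>B. representation B (F b) b)"

section \<open>Semi-Riemannian metrics and their curvature\<close>

type_synonym ('m, 'n) tensor02 = "'m \<Rightarrow> ('m, 'n) tvec \<Rightarrow> ('m, 'n) tvec \<Rightarrow> real"

type_synonym ('m, 'n) tensor13 =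
  "'m \<Rightarrow> ('m, 'n) tvec \<Rightarrow> ('m, 'n) tvec \<Rightarrow> ('m, 'n) tvec \<Rightarrow> ('m, 'n) tvec"

text \<open>The metric in the coordinates of the chart \<open>c\<close>, at the coordinate point \<open>x\<close>.\<close>

definition lmetric ::
    "('m, 'n::finite) chart set \<Rightarrow> ('m, 'n) tensor02 \<Rightarrow> ('m, 'n) chart \<Rightarrow>
     real ^ 'n \<Rightarrow> real ^ 'n \<Rightarrow> real ^ 'n \<Rightarrow> real" where
  "lmetric A g c x u v = g (cinv c x) (tv A c (cinv c x) u) (tv A c (cinv c x) v)"

definition metric_index ::
    "('m, 'n::finite) chart set \<Rightarrow> ('m, 'n) tensor02 \<Rightarrow> 'm \<Rightarrow> nat" where
  "metric_index A g p =
     Max {dim W | W. subspace W \<and> W \<subseteq> tangent_space A p \<and> (\<forall>w\<in>W. w \<noteq> 0 \<longrightarrow> g p w w < 0)}"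

definition semi_riemannian ::
    "('m::{t2_space,second_countable_topology}, 'n::finite) chart set \<Rightarrow> ('m, 'n) tensor02 \<Rightarrow> bool"
  where
  "semi_riemannian A g \<longleftrightarrow>
     smooth_atlas A \<and>
     (\<forall>p. \<forall>u\<in>tangent_space A p. \<forall>v\<in>tangent_space A p. g p u v = g p v u) \<and>
     (\<forall>p. \<forall>u\<in>tangent_space A p. \<forall>v\<in>tangent_space A p. \<forall>w\<in>tangent_space A p.
        g p (u + v) w = g p u w + g p v w) \<and>
     (\<forall>p. \<forall>u\<in>tangent_space A p. \<forall>w\<in>tangent_space A p. \<forall>t. g p (t *\<^sub>R u) w = t * g p u w) \<and>
     (\<forall>p. \<forall>u\<in>tangent_space A p. (\<forall>v\<in>tangent_space A p. g p u v = 0) \<longrightarrow> u = 0) \<and>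
     (\<forall>c\<in>A. \<forall>u v. smooth_on (coord c ` cdom c) (\<lambda>x. lmetric A g c x u v)) \<and>
     (\<exists>\<nu>. \<forall>p. metric_index A g p = \<nu>)"

text \<open>
  The Levi-Civita connection in coordinates. \<open>christoffel\<close> is the covariant derivative of the
  constant coordinate vector field \<open>v\<close> in direction \<open>u\<close>, given by the Koszul formula
  (constant coordinate fields commute, so its bracket terms vanish).
\<close>

definition christoffel ::
    "('m, 'n::finite) chart set \<Rightarrow> ('m, 'n) tensor02 \<Rightarrow> ('m, 'n) chart \<Rightarrow>
     real ^ 'n \<Rightarrow> real ^ 'n \<Rightarrow> real ^ 'n \<Rightarrow> real ^ 'n" where
  "christoffel A g c x u v =
     (THE w. \<forall>z. 2 * lmetric A g c x w z =
          frechet_derivative (\<lambda>y. lmetric A g c y v z) (at x) u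
        + frechet_derivative (\<lambda>y. lmetric A g c y u z) (at x) v
        - frechet_derivative (\<lambda>y. lmetric A g c y u v) (at x) z)"

definition lnabla ::
    "('m, 'n::finite) chart set \<Rightarrow> ('m, 'n) tensor02 \<Rightarrow> ('m, 'n) chart \<Rightarrow>
     (real ^ 'n \<Rightarrow> real ^ 'n) \<Rightarrow> (real ^ 'n \<Rightarrow> real ^ 'n) \<Rightarrow> real ^ 'n \<Rightarrow> real ^ 'n" where
  "lnabla A g c X Y x = frechet_derivative Y (at x) (X x) + christoffel A g c x (X x) (Y x)"

definition lbracket ::
    "(real ^ 'n \<Rightarrow> real ^ 'n) \<Rightarrow> (real ^ 'n \<Rightarrow> real ^ 'n) \<Rightarrow> real ^ 'n \<Rightarrow> real ^ 'n::finite" where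
  "lbracket X Y x = frechet_derivative Y (at x) (X x) - frechet_derivative X (at x) (Y x)"

definition lcurvature ::
    "('m, 'n::finite) chart set \<Rightarrow> ('m, 'n) tensor02 \<Rightarrow> ('m, 'n) chart \<Rightarrow>
     (real ^ 'n \<Rightarrow> real ^ 'n) \<Rightarrow> (real ^ 'n \<Rightarrow> real ^ 'n) \<Rightarrow> (real ^ 'n \<Rightarrow> real ^ 'n) \<Rightarrow>
     real ^ 'n \<Rightarrow> real ^ 'n" where
  "lcurvature A g c X Y Z x =
     lnabla A g c X (lnabla A g c Y Z) x - lnabla A g c Y (lnabla A g c X Z) x
     - lnabla A g c (lbracket X Y) Z x"

text \<open>
  The curvature tensor \<open>R(x,y)z\<close> at \<open>p\<close>: the curvature operator is evaluated on the extensions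
  of \<open>x\<close>, \<open>y\<close>, \<open>z\<close> with constant coefficients in some chart around \<open>p\<close>. Since the curvature
  operator is tensorial and commutes with changes of coordinates, the result depends neither on
  the extensions nor on the chart. With this sign a space of constant curvature \<open>c\<close> has
  \<open>R(X,Y)Z = c (g(Y,Z) X - g(X,Z) Y)\<close>.
\<close>

definition chart_at :: "('m, 'n) chart set \<Rightarrow> 'm \<Rightarrow> ('m, 'n) chart" where
  "chart_at A p = (SOME c. c \<in> A \<and> p \<in> cdom c)"

definition riemann ::
    "('m, 'n::finite) chart set \<Rightarrow> ('m, 'n) tensor02 \<Rightarrow> ('m, 'n) tensor13" where
  "riemann A g p x y z =
     (let c = chart_at A p in
      tv A c p (lcurvature A g c (\<lambda>_. comp x c) (\<lambda>_. comp y c) (\<lambda>_. comp z c) (coord c p)))"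

definition ricci ::
    "('m, 'n::finite) chart set \<Rightarrow> ('m, 'n) tensor02 \<Rightarrow> ('m, 'n) tensor02" where
  "ricci A g p y z = trace_on (tangent_space A p) (\<lambda>x. riemann A g p x y z)"

definition ricci_op ::
    "('m, 'n::finite) chart set \<Rightarrow> ('m, 'n) tensor02 \<Rightarrow> 'm \<Rightarrow> ('m, 'n) tvec \<Rightarrow> ('m, 'n) tvec" where
  "ricci_op A g p x =
     (THE w. w \<in> tangent_space A p \<and> (\<forall>y\<in>tangent_space A p. g p w y = ricci A g p x y))"

definition scalar_curv ::
    "('m, 'n::finite) chart set \<Rightarrow> ('m, 'n) tensor02 \<Rightarrow> 'm \<Rightarrow> real" where
  "scalar_curv A g p = trace_on (tangent_space A p) (ricci_op A g p)"

definition ricci_pow ::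
    "('m, 'n::finite) chart set \<Rightarrow> ('m, 'n) tensor02 \<Rightarrow> nat \<Rightarrow> ('m, 'n) tensor02" where
  "ricci_pow A g l p x y = g p ((ricci_op A g p ^^ l) x) y"

section \<open>Nullity distribution and \<open>(N(k), \<xi>)\<close>-semi-Riemannian manifolds\<close>

definition nullity ::
    "('m, 'n::finite) chart set \<Rightarrow> ('m, 'n) tensor02 \<Rightarrow> real \<Rightarrow> 'm \<Rightarrow> ('m, 'n) tvec set" where
  "nullity A g k p =
     {z \<in> tangent_space A p. \<forall>x\<in>tangent_space A p. \<forall>y\<in>tangent_space A p.
        riemann A g p x y z = k *\<^sub>R (g p y z *\<^sub>R x - g p x z *\<^sub>R y)}"

definition Nk_semi_riemannian ::
    "('m::{t2_space,second_countable_topology}, 'n::finite) chart set \<Rightarrow> ('m, 'n) tensor02 \<Rightarrow>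
     real \<Rightarrow> real \<Rightarrow> ('m \<Rightarrow> ('m, 'n) tvec) \<Rightarrow> bool" where
  "Nk_semi_riemannian A g k \<epsilon> \<xi> \<longleftrightarrow>
     semi_riemannian A g \<and> smooth_vector_field A \<xi> \<and> \<epsilon> \<in> {1, -1} \<and>
     (\<forall>p. g p (\<xi> p) (\<xi> p) = \<epsilon> \<and> \<xi> p \<in> nullity A g k p)"

section \<open>The tensor \<open>T\<^sub>a\<close> and pseudosymmetry\<close>

text \<open>Of the coefficient sequence \<open>a\<close> only the entries \<open>a 0, \<dots>, a 7\<close> are used.\<close>

definition Ta ::
    "('m, 'n::finite) chart set \<Rightarrow> ('m, 'n) tensor02 \<Rightarrow> (nat \<Rightarrow> real) \<Rightarrow> ('m, 'n) tensor13" where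
  "Ta A g a p x y z =
     a 0 *\<^sub>R riemann A g p x y z
     + (a 1 * ricci A g p y z) *\<^sub>R x + (a 2 * ricci A g p x z) *\<^sub>R y
     + (a 3 * ricci A g p x y) *\<^sub>R z
     + (a 4 * g p y z) *\<^sub>R ricci_op A g p x + (a 5 * g p x z) *\<^sub>R ricci_op A g p y
     + (a 6 * g p x y) *\<^sub>R ricci_op A g p z
     + (a 7 * scalar_curv A g p) *\<^sub>R (g p y z *\<^sub>R x - g p x z *\<^sub>R y)"

text \<open>The action of an endomorphism \<open>F\<close> of \<open>V\<close> on a (1,3) tensor over \<open>V\<close>, as a derivation.\<close>

definition endo_act ::
    "('v \<Rightarrow> 'v) \<Rightarrow> ('v \<Rightarrow> 'v \<Rightarrow> 'v \<Rightarrow> 'v) \<Rightarrow> 'v \<Rightarrow> 'v \<Rightarrow> 'v \<Rightarrow> 'v::real_vector" where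
  "endo_act F T u v w = F (T u v w) - T (F u) v w - T u (F v) w - T u v (F w)"

definition wedge ::
    "('v \<Rightarrow> 'v \<Rightarrow> real) \<Rightarrow> 'v \<Rightarrow> 'v \<Rightarrow> 'v \<Rightarrow> 'v::real_vector" where
  "wedge \<sigma> z x y = \<sigma> x y *\<^sub>R z - \<sigma> z y *\<^sub>R x"

definition R_dot ::
    "('m, 'n::finite) chart set \<Rightarrow> ('m, 'n) tensor02 \<Rightarrow> ('m, 'n) tensor13 \<Rightarrow> 'm \<Rightarrow>
     ('m, 'n) tvec \<Rightarrow> ('m, 'n) tvec \<Rightarrow> ('m, 'n) tvec \<Rightarrow> ('m, 'n) tvec \<Rightarrow> ('m, 'n) tvec \<Rightarrow>
     ('m, 'n) tvec" where
  "R_dot A g T p u v w z x = endo_act (riemann A g p z x) (T p) u v w"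

definition Q_tachibana ::
    "('m, 'n::finite) tensor02 \<Rightarrow> ('m, 'n) tensor13 \<Rightarrow> 'm \<Rightarrow>
     ('m, 'n) tvec \<Rightarrow> ('m, 'n) tvec \<Rightarrow> ('m, 'n) tvec \<Rightarrow> ('m, 'n) tvec \<Rightarrow> ('m, 'n) tvec \<Rightarrow>
     ('m, 'n) tvec" where
  "Q_tachibana \<sigma> T p u v w z x = endo_act (wedge (\<sigma> p) z x) (T p) u v w"

definition nonvanishing_set ::
    "('m, 'n::finite) chart set \<Rightarrow> ('m, 'n) tensor02 \<Rightarrow> (nat \<Rightarrow> real) \<Rightarrow> nat \<Rightarrow> 'm set" where
  "nonvanishing_set A g a l =
     {p. \<exists>u\<in>tangent_space A p. \<exists>v\<in>tangent_space A p. \<exists>w\<in>tangent_space A p.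
         \<exists>z\<in>tangent_space A p. \<exists>x\<in>tangent_space A p.
           Q_tachibana (ricci_pow A g l) (Ta A g a) p u v w z x \<noteq> 0}"

text \<open>
  \<open>(R, T\<^sub>a, S^l)\<close>-pseudosymmetry with associated function \<open>L\<close>; only the values of \<open>L\<close> on
  \<open>nonvanishing_set A g a l\<close> matter.
\<close>

definition pseudosymmetric ::
    "('m, 'n::finite) chart set \<Rightarrow> ('m, 'n) tensor02 \<Rightarrow> (nat \<Rightarrow> real) \<Rightarrow> nat \<Rightarrow> ('m \<Rightarrow> real) \<Rightarrow> bool"
  where
  "pseudosymmetric A g a l L \<longleftrightarrow>
     smooth_fun_on A (nonvanishing_set A g a l) L \<and>
     (\<forall>p\<in>nonvanishing_set A g a l.
        \<forall>u\<in>tangent_space A p. \<forall>v\<in>tangent_space A p. \<forall>w\<in>tangent_space A p.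
        \<forall>z\<in>tangent_space A p. \<forall>x\<in>tangent_space A p.
          R_dot A g (Ta A g a) p u v w z x =
            L p *\<^sub>R Q_tachibana (ricci_pow A g l) (Ta A g a) p u v w z x)"

end

theory Submission
  imports Defs
begin

text \<open>
  Fix a point of the manifold. The nullity condition on \<open>\<xi>\<close> together with the pair symmetry
  \<open>g(R(x,y)z,w) = g(R(z,w)x,y)\<close> of the curvature says that \<open>R(\<xi>,X) = k (\<xi> \<and> X)\<close>, where the wedge
  product is formed with \<open>g = S^0\<close>. Therefore the left-hand side \<open>R(\<xi>,X)\<cdot>T\<close> of the pseudosymmetry
  equation is \<open>k\<close> times the case \<open>l = 0\<close> of the tensor \<open>Q(S^l,T)\<close> on the right, and a single
  computation serves both sides: evaluate \<open>((\<xi> \<and> X)\<cdot>T)(\<xi>,V)W\<close>, with the wedge product formed by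
  \<open>S^l\<close>, and pair it with \<open>\<xi>\<close>. All curvature terms of \<open>T\<close> become explicit, by the formula
  for \<open>R(\<xi>,X)\<close> or because \<open>g(R(x,y)z,\<xi>) = -g(R(x,y)\<xi>,z)\<close>. The Ricci terms are
  evaluated with \<open>Q \<xi> = k(n-1) \<xi>\<close> and with the self-adjointness of \<open>Q\<close>, which turns
  \<open>S^l(X, Q V)\<close> into \<open>S^(l+1)(X,V)\<close>. The result is \<open>normal_component_wedge_action\<close>.

  All this is linear algebra in one tangent space, for an arbitrary \<open>R\<close> with the symmetries
  of a curvature tensor. The Ricci tensor is symmetric because \<open>R(\<cdot>,y)z\<close> and \<open>R(\<cdot>,z)y\<close> are adjoint
  and adjoint maps have the same trace (\<open>trace_adjoint\<close>); nondegeneracy provides the Ricci operator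
  (\<open>riesz\<close>).

  The curvature symmetries are proved for the coordinate expression of the curvature in a chart. The Bianchi
  identity reflects the symmetry of the Christoffel symbols. Skew-adjointness of \<open>R(x,y)\<close> follows
  by differentiating the compatibility of the connection with the metric, using that second partial
  derivatives commute (\<open>mixed_partials_commute\<close>) and that the Christoffel symbols are differentiable
  (\<open>christoffel_differentiable\<close>).
\<close>

section \<open>Linear maps and traces on a finite-dimensional subspace\<close>

text \<open>
  The metric and the curvature are controlled on tangent vectors only, while the type \<open>tvec\<close> contains
  many other elements, so linearity has to be relativised to a subspace.
\<close>

definition linear_on_space :: "'v::real_vector set \<Rightarrow> ('v \<Rightarrow> 'w::real_vector) \<Rightarrow> bool" where
  "linear_on_space V f \<longleftrightarrow>
     (\<forall>x\<in>V. \<forall>y\<in>V. f (x + y) = f x + f y) \<and> (\<forall>x\<in>V. \<forall>c. f (c *\<^sub>R x) = c *\<^sub>R f x)"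

lemma linear_on_spaceI:
  assumes "\<And>x y. x \<in> V \<Longrightarrow> y \<in> V \<Longrightarrow> f (x + y) = f x + f y"
    and "\<And>c x. x \<in> V \<Longrightarrow> f (c *\<^sub>R x) = c *\<^sub>R f x"
  shows "linear_on_space V f"
  using assms by (simp add: linear_on_space_def)

lemma linear_on_space_add: "linear_on_space V f \<Longrightarrow> x \<in> V \<Longrightarrow> y \<in> V \<Longrightarrow> f (x + y) = f x + f y"
  and linear_on_space_scale: "linear_on_space V f \<Longrightarrow> x \<in> V \<Longrightarrow> f (c *\<^sub>R x) = c *\<^sub>R f x"
  by (auto simp: linear_on_space_def)

text \<open>
  Passing to a total linear map makes the facts on \<open>linear\<close> applicable.
\<close>

lemma linear_on_space_extend:
  assumes V: "subspace V" and f: "linear_on_space V f"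
  obtains F where "linear F" "\<And>x. x \<in> V \<Longrightarrow> F x = f x"
proof -
  obtain B where B: "B \<subseteq> V" "independent B" "V \<subseteq> span B"
    using real_vector.maximal_independent_subset[of V] by blast
  obtain F where F: "linear F" "\<forall>x\<in>B. F x = f x"
    using real_vector.linear_independent_extend[OF B(2)] by (auto simp: linear_def[symmetric])
  have "x \<in> V \<and> F x = f x" if "x \<in> span B" for x
    using that
  proof (induction rule: span_induct_alt)
    case base
    have "f (0 *\<^sub>R 0) = 0 *\<^sub>R f 0"
      using subspace_0[OF V] by (rule linear_on_space_scale[OF f])
    then show ?case using subspace_0[OF V] linear_0[OF F(1)] by simp
  next
    case (step c b y)
    then have "b \<in> V" using B(1) by blast
    with step F V f show ?case
      by (auto simp: linear_add linear_scale linear_on_space_add linear_on_space_scale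
          subspace_add subspace_scale)
  qed
  with F(1) B(3) that show thesis by blast
qed

lemma linear_on_space_sum:
  assumes "subspace V" "linear_on_space V f" "\<And>i. i \<in> I \<Longrightarrow> x i \<in> V"
  shows "f (\<Sum>i\<in>I. c i *\<^sub>R x i) = (\<Sum>i\<in>I. c i *\<^sub>R f (x i))"
proof -
  obtain F where F: "linear F" "\<And>x. x \<in> V \<Longrightarrow> F x = f x"
    using linear_on_space_extend[OF assms(1,2)] by blast
  have "f (\<Sum>i\<in>I. c i *\<^sub>R x i) = F (\<Sum>i\<in>I. c i *\<^sub>R x i)"
    by (rule F(2)[symmetric]) (intro subspace_sum subspace_scale assms)
  also have "\<dots> = (\<Sum>i\<in>I. c i *\<^sub>R F (x i))"
    by (simp add: linear_sum[OF F(1)] linear_scale[OF F(1)])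
  also have "\<dots> = (\<Sum>i\<in>I. c i *\<^sub>R f (x i))"
    using F(2) assms(3) by simp
  finally show ?thesis .
qed

locale finite_dimensional_subspace =
  fixes V :: "'v::real_vector set"
  assumes subspace: "subspace V"
    and finitely_generated: "\<exists>B. finite B \<and> span B = V"
begin

lemmas closed [simp] = subspace_0[OF subspace] subspace_add[OF subspace]
  subspace_diff[OF subspace] subspace_scale[OF subspace] subspace_neg[OF subspace]

text \<open>
  The basis chosen inside \<open>trace_on\<close> is the same for all endomorphisms of \<open>V\<close>, so that traces of
  different maps can be compared summand by summand, without a change of basis.
\<close>

lemma trace_basis:
  obtains B where "finite B" "independent B" "span B = V" "card B = dim V"
    "\<And>F. trace_on V F = (\<Sum>b\<in>B. representation B (F b) b)"
proof -
  define B where "B = (SOME B. independent B \<and> span B = V)"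
  obtain C where C: "finite C" "span C = V" using finitely_generated by blast
  obtain D where D: "D \<subseteq> V" "independent D" "V \<subseteq> span D"
    using real_vector.maximal_independent_subset[of V] by blast
  then have "span D = V" using span_minimal[OF D(1) subspace] by blast
  with D have "\<exists>B. independent B \<and> span B = V" by blast
  then have B: "independent B \<and> span B = V" unfolding B_def by (rule someI_ex)
  then have "finite B"
    using real_vector.independent_span_bound[OF C(1), of B] C(2) span_superset[of B] by auto
  moreover have "card B = dim V"
    using B real_vector.dim_span_eq_card_independent[of B] by auto
  ultimately show thesis using B that unfolding trace_on_def Let_def B_def by blast
qed

lemma trace_cong: "trace_on V F = trace_on V G" if "\<And>x. x \<in> V \<Longrightarrow> F x = G x"
proof -
  obtain B where B: "span B = V" "\<And>F. trace_on V F = (\<Sum>b\<in>B. representation B (F b) b)"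
    by (rule trace_basis) blast
  have "b \<in> V" if "b \<in> B" for b using B(1) that by (auto intro: span_base)
  with that show ?thesis by (simp add: B(2))
qed

lemma trace_add:
  assumes "\<And>x. x \<in> V \<Longrightarrow> F x \<in> V" "\<And>x. x \<in> V \<Longrightarrow> G x \<in> V"
  shows "trace_on V (\<lambda>x. F x + G x) = trace_on V F + trace_on V G"
proof -
  obtain B where B: "independent B" "span B = V"
    "\<And>F. trace_on V F = (\<Sum>b\<in>B. representation B (F b) b)"
    by (rule trace_basis) blast
  have "b \<in> V" if "b \<in> B" for b using B(2) that by (auto intro: span_base)
  with assms B show ?thesis by (simp add: real_vector.representation_add sum.distrib)
qed

lemma trace_scale:
  assumes "\<And>x. x \<in> V \<Longrightarrow> F x \<in> V"
  shows "trace_on V (\<lambda>x. c *\<^sub>R F x) = c * trace_on V F"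
proof -
  obtain B where B: "independent B" "span B = V"
    "\<And>F. trace_on V F = (\<Sum>b\<in>B. representation B (F b) b)"
    by (rule trace_basis) blast
  have "b \<in> V" if "b \<in> B" for b using B(2) that by (auto intro: span_base)
  with assms B show ?thesis by (simp add: real_vector.representation_scale sum_distrib_left)
qed

lemma trace_identity: "trace_on V (\<lambda>x. x) = dim V"
proof -
  obtain B where B: "independent B" "card B = dim V"
    "\<And>F. trace_on V F = (\<Sum>b\<in>B. representation B (F b) b)"
    by (rule trace_basis) blast
  then show ?thesis by (simp add: real_vector.representation_basis)
qed

text \<open>
  For \<open>\<xi>\<close> in the nullity space, the map \<open>x \<mapsto> R(x, y)\<xi>\<close> is the sum of a multiple of the identity and
  of such a rank one map, which gives the Ricci tensor in the direction \<open>\<xi>\<close>.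
  Every endomorphism is a sum of rank one maps, which also makes this the main tool for \<open>trace_adjoint\<close> below.
\<close>

lemma trace_rank_one:
  assumes f: "linear_on_space V f" and w: "w \<in> V"
  shows "trace_on V (\<lambda>x. f x *\<^sub>R w) = f w"
proof -
  obtain B where B: "finite B" "independent B" "span B = V"
    "\<And>F. trace_on V F = (\<Sum>b\<in>B. representation B (F b) b)"
    by (rule trace_basis) blast
  have BV: "b \<in> V" if "b \<in> B" for b using B(3) that by (auto intro: span_base)
  have w_eq: "(\<Sum>b\<in>B. representation B w b *\<^sub>R b) = w"
    using B w by (intro real_vector.sum_representation_eq) auto
  have "trace_on V (\<lambda>x. f x *\<^sub>R w) = (\<Sum>b\<in>B. representation B w b *\<^sub>R f b)"
    using B w by (simp add: real_vector.representation_scale mult.commute)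
  also have "\<dots> = f (\<Sum>b\<in>B. representation B w b *\<^sub>R b)"
    by (rule linear_on_space_sum[OF subspace f BV, symmetric])
  finally show ?thesis by (simp add: w_eq)
qed

lemma trace_sum:
  assumes "\<And>i x. i \<in> I \<Longrightarrow> x \<in> V \<Longrightarrow> F i x \<in> V" "finite I"
  shows "trace_on V (\<lambda>x. \<Sum>i\<in>I. F i x) = (\<Sum>i\<in>I. trace_on V (F i))"
  using assms(2,1)
proof (induction rule: finite_induct)
  case empty
  show ?case using trace_scale[of "\<lambda>x. x" 0] by simp
next
  case (insert i I)
  then have "trace_on V (\<lambda>x. F i x + (\<Sum>i\<in>I. F i x)) = trace_on V (F i) + trace_on V (\<lambda>x. \<Sum>i\<in>I. F i x)"
    by (intro trace_add subspace_sum[OF subspace]) auto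
  with insert show ?case by simp
qed

end

section \<open>Scalar product spaces\<close>

locale scalar_product_space = finite_dimensional_subspace V
  for V :: "'v::real_vector set" +
  fixes g :: "'v \<Rightarrow> 'v \<Rightarrow> real"
  assumes sym: "u \<in> V \<Longrightarrow> v \<in> V \<Longrightarrow> g u v = g v u"
    and add_left: "u \<in> V \<Longrightarrow> v \<in> V \<Longrightarrow> w \<in> V \<Longrightarrow> g (u + v) w = g u w + g v w"
    and scale_left: "u \<in> V \<Longrightarrow> w \<in> V \<Longrightarrow> g (t *\<^sub>R u) w = t * g u w"
    and nondegenerate: "u \<in> V \<Longrightarrow> (\<And>v. v \<in> V \<Longrightarrow> g u v = 0) \<Longrightarrow> u = 0"
begin

lemma add_right: "u \<in> V \<Longrightarrow> v \<in> V \<Longrightarrow> w \<in> V \<Longrightarrow> g u (v + w) = g u v + g u w"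
  by (metis add_left closed(2) sym)

lemma scale_right: "u \<in> V \<Longrightarrow> w \<in> V \<Longrightarrow> g u (t *\<^sub>R w) = t * g u w"
  by (metis scale_left closed(4) sym)

lemma minus_left: "u \<in> V \<Longrightarrow> w \<in> V \<Longrightarrow> g (- u) w = - g u w"
  using scale_left[of u w "-1"] by simp

lemma minus_right: "u \<in> V \<Longrightarrow> w \<in> V \<Longrightarrow> g u (- w) = - g u w"
  using scale_right[of u w "-1"] by simp

lemma diff_left: "u \<in> V \<Longrightarrow> v \<in> V \<Longrightarrow> w \<in> V \<Longrightarrow> g (u - v) w = g u w - g v w"
  using add_left[of u "-v" w] minus_left[of v w] by simp

lemma diff_right: "u \<in> V \<Longrightarrow> v \<in> V \<Longrightarrow> w \<in> V \<Longrightarrow> g u (v - w) = g u v - g u w"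
  using add_right[of u v "-w"] minus_right[of u w] by simp

lemmas bilinear = add_left add_right scale_left scale_right minus_left minus_right diff_left diff_right

lemma linear_left: "v \<in> V \<Longrightarrow> linear_on_space V (\<lambda>u. g u v)"
  by (rule linear_on_spaceI) (auto simp: bilinear)

lemma linear_right: "u \<in> V \<Longrightarrow> linear_on_space V (\<lambda>v. g u v)"
  by (rule linear_on_spaceI) (auto simp: bilinear)

lemma eq_by_metric:
  assumes "u \<in> V" "v \<in> V" "\<And>w. w \<in> V \<Longrightarrow> g u w = g v w"
  shows "u = v"
  using nondegenerate[of "u - v"] assms by (simp add: diff_left)

text \<open>
  A scalar product may be indefinite, so projections onto lines are not always available. Instead,
  nondegeneracy says that the map \<open>\<Phi>\<close>, which sends \<open>u\<close> to the vector with the coordinates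
  \<open>g u b\<close>, is injective on \<open>V\<close>; an injective endomorphism of a finite-dimensional space is onto.
\<close>

lemma riesz:
  assumes f: "linear_on_space V f"
  obtains w where "w \<in> V" "\<And>y. y \<in> V \<Longrightarrow> g w y = f y"
proof -
  obtain B where B: "finite B" "independent B" "span B = V"
    by (rule trace_basis) blast
  have BV: "b \<in> V" if "b \<in> B" for b using B(3) that by (auto intro: span_base)
  have expand: "h y = (\<Sum>b\<in>B. representation B y b *\<^sub>R h b)"
    if "linear_on_space V h" "y \<in> V" for h :: "'v \<Rightarrow> real" and y
  proof -
    have "(\<Sum>b\<in>B. representation B y b *\<^sub>R b) = y"
      using B that by (intro real_vector.sum_representation_eq) auto
    then show ?thesis using linear_on_space_sum[OF subspace that(1) BV, of B "\<lambda>b. b" "representation B y"]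
      by simp
  qed
  define \<Phi> where "\<Phi> u = (\<Sum>b\<in>B. g u b *\<^sub>R b)" for u
  have "linear_on_space V \<Phi>"
    by (rule linear_on_spaceI)
      (simp_all add: \<Phi>_def BV bilinear algebra_simps sum.distrib scaleR_sum_right)
  then obtain F where F: "linear F" "\<And>x. x \<in> V \<Longrightarrow> F x = \<Phi> x"
    using linear_on_space_extend[OF subspace] by blast
  have coeffs: "g u b = c b" if "\<Phi> u = (\<Sum>b\<in>B. c b *\<^sub>R b)" "b \<in> B" for u c b
  proof -
    have "(\<Sum>b\<in>B. (g u b - c b) *\<^sub>R b) = 0"
      using that(1) by (simp add: \<Phi>_def algebra_simps sum_subtractf)
    from real_vector.independentD[OF B(2,1) _ this that(2)] show ?thesis by simp
  qed
  have inj: "inj_on F (span B)"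
  proof (rule inj_onI)
    fix u v assume uv: "u \<in> span B" "v \<in> span B" "F u = F v"
    then have V: "u - v \<in> V" using B(3) by auto
    have "\<Phi> (u - v) = 0"
      using uv F(2)[OF V] linear_diff[OF F(1), of u v] by simp
    then have zero: "g (u - v) b = 0" if "b \<in> B" for b using coeffs[of "u - v" "\<lambda>_. 0"] that by simp
    have "g (u - v) y = 0" if "y \<in> V" for y
      using expand[OF linear_right[OF V] that] zero by simp
    then show "u = v" using nondegenerate[OF V] by simp
  qed
  have ind: "independent (F ` B)"
    by (rule real_vector.linear_independent_injective_image[OF _ B(2) inj]) (use F(1) in \<open>simp add: linear_def\<close>)
  have card: "card (F ` B) = card B"
    by (rule card_image) (meson inj inj_on_subset span_superset)
  have FB: "F ` B \<subseteq> span B"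
    unfolding B(3) by (rule image_subsetI) (simp add: BV F(2) \<Phi>_def subspace_sum[OF subspace])
  have "B \<subseteq> span (F ` B)"
  proof
    \<comment> \<open>Otherwise \<open>span B\<close> would contain an independent set with more elements than \<open>B\<close>.\<close>
    fix b assume b: "b \<in> B"
    show "b \<in> span (F ` B)"
    proof (rule ccontr)
      assume nb: "b \<notin> span (F ` B)"
      then have "independent (insert b (F ` B))"
        by (simp add: real_vector.independent_insert ind)
      moreover have "insert b (F ` B) \<subseteq> span B" using FB b by (simp add: span_base)
      ultimately have "card (insert b (F ` B)) \<le> card B"
        using real_vector.independent_span_bound[OF B(1)] by blast
      moreover have "b \<notin> F ` B" using nb span_base[of b "F ` B"] by (rule contrapos_nn)
      ultimately show False by (simp add: card card_insert_disjoint[OF finite_imageI[OF B(1)]])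
    qed
  qed
  then have "span B \<subseteq> span (F ` B)" by (rule span_minimal) (rule subspace_span)
  then have "V \<subseteq> F ` span B" by (simp only: linear_span_image[OF F(1)] B(3))
  moreover have "(\<Sum>b\<in>B. f b *\<^sub>R b) \<in> V"
    using BV by (intro subspace_sum[OF subspace]) simp
  ultimately have "(\<Sum>b\<in>B. f b *\<^sub>R b) \<in> F ` V" unfolding B(3) by blast
  then obtain w where "w \<in> V" "F w = (\<Sum>b\<in>B. f b *\<^sub>R b)" by auto
  with F(2) have w: "w \<in> V" "\<Phi> w = (\<Sum>b\<in>B. f b *\<^sub>R b)" by simp_all
  have "g w y = f y" if "y \<in> V" for y
  proof -
    have "g w y = (\<Sum>b\<in>B. representation B y b *\<^sub>R g w b)"
      by (rule expand[OF linear_right[OF w(1)] that])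
    also have "\<dots> = (\<Sum>b\<in>B. representation B y b *\<^sub>R f b)"
      by (rule sum.cong[OF refl]) (simp only: coeffs[OF w(2)])
    also have "\<dots> = f y" by (rule expand[OF f that, symmetric])
    finally show ?thesis .
  qed
  with w(1) that show thesis by blast
qed

text \<open>
  If \<open>F = (\<Sum>b. g (d b) \<cdot> F b)\<close> with the dual basis \<open>d\<close>, then the adjoint is
  \<open>(\<Sum>b. g (F b) \<cdot> d b)\<close>, and the trace of either sum of rank one maps is \<open>\<Sum>b. g (d b) (F b)\<close>.
\<close>

lemma trace_adjoint:
  assumes F: "linear_on_space V F" "\<And>x. x \<in> V \<Longrightarrow> F x \<in> V"
    and G: "\<And>x. x \<in> V \<Longrightarrow> G x \<in> V"
    and adj: "\<And>x y. x \<in> V \<Longrightarrow> y \<in> V \<Longrightarrow> g (F x) y = g x (G y)"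
  shows "trace_on V G = trace_on V F"
proof -
  obtain B where B: "finite B" "independent B" "span B = V"
    by (rule trace_basis) blast
  have BV: "b \<in> V" if "b \<in> B" for b using B(3) that by (auto intro: span_base)
  have linrep: "linear_on_space V (\<lambda>x. representation B x b)" for b
    using B by (intro linear_on_spaceI)
      (simp_all add: real_vector.representation_add real_vector.representation_scale)
  have "\<exists>d. d \<in> V \<and> (\<forall>y\<in>V. g d y = representation B y b)" for b
    by (rule riesz[OF linrep[of b]]) blast
  then obtain d where d: "\<And>b. d b \<in> V" "\<And>b y. y \<in> V \<Longrightarrow> g (d b) y = representation B y b"
    by metis
  have expand: "(\<Sum>b\<in>B. g (d b) x *\<^sub>R b) = x" if "x \<in> V" for x
  proof -
    have "(\<Sum>b\<in>B. representation B x b *\<^sub>R b) = x"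
      using B that by (intro real_vector.sum_representation_eq) auto
    then show ?thesis by (simp only: d(2)[OF that])
  qed
  have F_eq: "F x = (\<Sum>b\<in>B. g (d b) x *\<^sub>R F b)" if "x \<in> V" for x
    using linear_on_space_sum[OF subspace F(1) BV, of B "\<lambda>b. b" "\<lambda>b. g (d b) x"]
    by (simp only: expand[OF that])
  have G_eq: "G y = (\<Sum>b\<in>B. g (F b) y *\<^sub>R d b)" if y: "y \<in> V" for y
  proof (rule eq_by_metric)
    show "(\<Sum>b\<in>B. g (F b) y *\<^sub>R d b) \<in> V" using d by (intro subspace_sum[OF subspace]) simp
    fix x assume x: "x \<in> V"
    have "g (G y) x = g (F x) y" using adj x y G sym by metis
    also have "\<dots> = (\<Sum>b\<in>B. g (d b) x * g (F b) y)"
      using F_eq[OF x] linear_on_space_sum[OF subspace linear_left[OF y], of B F "\<lambda>b. g (d b) x"] F(2) BV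
      by simp
    also have "\<dots> = g (\<Sum>b\<in>B. g (F b) y *\<^sub>R d b) x"
      using linear_on_space_sum[OF subspace linear_left[OF x], of B d "\<lambda>b. g (F b) y"] d
      by (simp add: mult.commute)
    finally show "g (G y) x = g (\<Sum>b\<in>B. g (F b) y *\<^sub>R d b) x" .
  qed (use G y in auto)
  have "trace_on V G = trace_on V (\<lambda>y. \<Sum>b\<in>B. g (F b) y *\<^sub>R d b)"
    by (rule trace_cong) (rule G_eq)
  also have "\<dots> = (\<Sum>b\<in>B. g (F b) (d b))"
    using B(1) d F(2) BV by (simp add: trace_sum trace_rank_one linear_right)
  also have "\<dots> = (\<Sum>b\<in>B. g (d b) (F b))"
    by (rule sum.cong) (use d F(2) BV sym in auto)
  also have "\<dots> = trace_on V (\<lambda>x. \<Sum>b\<in>B. g (d b) x *\<^sub>R F b)"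
    using B(1) d F(2) BV by (simp add: trace_sum trace_rank_one linear_right)
  also have "\<dots> = trace_on V F"
    by (rule trace_cong) (rule F_eq[symmetric])
  finally show ?thesis .
qed

end

section \<open>Algebraic curvature tensors\<close>

locale algebraic_curvature = scalar_product_space V g
  for V :: "'v::real_vector set" and g +
  fixes R :: "'v \<Rightarrow> 'v \<Rightarrow> 'v \<Rightarrow> 'v"
  assumes R_closed [simp]: "x \<in> V \<Longrightarrow> y \<in> V \<Longrightarrow> z \<in> V \<Longrightarrow> R x y z \<in> V"
    and R_linear: "y \<in> V \<Longrightarrow> z \<in> V \<Longrightarrow> linear_on_space V (\<lambda>x. R x y z)"
    and R_swap: "x \<in> V \<Longrightarrow> y \<in> V \<Longrightarrow> z \<in> V \<Longrightarrow> R y x z = - R x y z"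
    and R_skew: "x \<in> V \<Longrightarrow> y \<in> V \<Longrightarrow> z \<in> V \<Longrightarrow> w \<in> V \<Longrightarrow> g (R x y z) w = - g (R x y w) z"
    and R_bianchi: "x \<in> V \<Longrightarrow> y \<in> V \<Longrightarrow> z \<in> V \<Longrightarrow> R x y z + R y z x + R z x y = 0"
begin

text \<open>
  The classical octahedron argument: add up the Bianchi identities for the four cyclic shifts of
  the arguments; the two skew symmetries cancel all but two kinds of terms.
\<close>

lemma R_pair:
  assumes [simp]: "x \<in> V" "y \<in> V" "z \<in> V" "w \<in> V"
  shows "g (R x y z) w = g (R z w x) y"
proof -
  have cyc: "g (R a b c) d + g (R b c a) d + g (R c a b) d = 0"
    if [simp]: "a \<in> V" "b \<in> V" "c \<in> V" "d \<in> V" for a b c d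
    using arg_cong[OF R_bianchi[OF that(1-3)], of "\<lambda>u. g u d"] scale_left[of 0 d 0]
    by (simp add: add_left)
  have swap: "g (R b a c) d = - g (R a b c) d"
    if [simp]: "a \<in> V" "b \<in> V" "c \<in> V" "d \<in> V" for a b c d
    using R_swap[of a b c] by (simp add: minus_left)
  note assms [simp]
  show ?thesis
    using cyc[of x y z w] cyc[of y z w x] cyc[of z w x y] cyc[of w x y z]
      swap[of x y z w] swap[of x y w z] swap[of z w x y] swap[of z w y x]
      swap[of y z x w] swap[of y z w x] swap[of x w y z] swap[of x w z y]
      swap[of z x y w] swap[of z x w y] swap[of y w x z] swap[of y w z x]
      R_skew[of x y z w] R_skew[of y z x w] R_skew[of z x y w] R_skew[of z w x y]
      R_skew[of x w y z] R_skew[of w x y z] R_skew[of y w z x] R_skew[of w y z x]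
    by simp
qed

text \<open>
  The pair symmetry turns linearity in the first argument into linearity in the third.
\<close>

lemma R_linear3:
  assumes [simp]: "x \<in> V" "y \<in> V"
  shows "linear_on_space V (\<lambda>z. R x y z)"
proof (rule linear_on_spaceI)
  fix z z' assume [simp]: "z \<in> V" "z' \<in> V"
  show "R x y (z + z') = R x y z + R x y z'"
    by (rule eq_by_metric) (simp_all add: R_pair[of x y] add_left linear_on_space_add[OF R_linear])
next
  fix c z assume [simp]: "z \<in> V"
  show "R x y (c *\<^sub>R z) = c *\<^sub>R R x y z"
    by (rule eq_by_metric) (simp_all add: R_pair[of x y] scale_left linear_on_space_scale[OF R_linear])
qed

definition ric :: "'v \<Rightarrow> 'v \<Rightarrow> real" where
  "ric y z = trace_on V (\<lambda>x. R x y z)"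

definition ricop :: "'v \<Rightarrow> 'v" where
  "ricop x = (THE w. w \<in> V \<and> (\<forall>y\<in>V. g w y = ric x y))"

text \<open>
  By the pair symmetry, \<open>R(\<cdot>, y)z\<close> and \<open>R(\<cdot>, z)y\<close> are adjoint to each other, so they have the same trace.
\<close>

lemma ric_sym:
  assumes [simp]: "y \<in> V" "z \<in> V"
  shows "ric y z = ric z y"
  unfolding ric_def
proof (rule trace_adjoint)
  fix x w assume [simp]: "x \<in> V" "w \<in> V"
  have "g (R x z y) w = g (R y w x) z" by (simp add: R_pair)
  also have "\<dots> = - g (R y w z) x" by (rule R_skew) auto
  also have "\<dots> = g (R w y z) x" using R_swap[of w y z] by (simp add: minus_left)
  also have "\<dots> = g x (R w y z)" by (simp add: sym)
  finally show "g (R x z y) w = g x (R w y z)" .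
qed (simp_all add: R_linear)

lemma ric_linear: "x \<in> V \<Longrightarrow> linear_on_space V (\<lambda>y. ric x y)"
proof (rule linear_on_spaceI)
  fix y z assume [simp]: "x \<in> V" "y \<in> V" "z \<in> V"
  have "ric x (y + z) = trace_on V (\<lambda>w. R w x y + R w x z)"
    unfolding ric_def by (rule trace_cong) (simp add: linear_on_space_add[OF R_linear3])
  then show "ric x (y + z) = ric x y + ric x z" by (simp add: trace_add ric_def)
next
  fix c y assume [simp]: "x \<in> V" "y \<in> V"
  have "ric x (c *\<^sub>R y) = trace_on V (\<lambda>w. c *\<^sub>R R w x y)"
    unfolding ric_def by (rule trace_cong) (simp add: linear_on_space_scale[OF R_linear3])
  then show "ric x (c *\<^sub>R y) = c *\<^sub>R ric x y" by (simp add: trace_scale ric_def)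
qed

lemma ricop:
  assumes "x \<in> V"
  shows ricop_closed [simp]: "ricop x \<in> V"
    and metric_ricop: "y \<in> V \<Longrightarrow> g (ricop x) y = ric x y"
proof -
  obtain w where w: "w \<in> V" "\<And>y. y \<in> V \<Longrightarrow> g w y = ric x y"
    by (rule riesz[OF ric_linear[OF assms]]) blast
  have "\<exists>!w. w \<in> V \<and> (\<forall>y\<in>V. g w y = ric x y)"
  proof (rule ex1I[of _ w])
    show "w \<in> V \<and> (\<forall>y\<in>V. g w y = ric x y)" using w by simp
  next
    fix w' assume "w' \<in> V \<and> (\<forall>y\<in>V. g w' y = ric x y)"
    with w show "w' = w" by (intro eq_by_metric) simp_all
  qed
  from theI'[OF this] show "ricop x \<in> V" "y \<in> V \<Longrightarrow> g (ricop x) y = ric x y"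
    unfolding ricop_def by simp_all
qed

lemma ricop_selfadjoint: "x \<in> V \<Longrightarrow> y \<in> V \<Longrightarrow> g (ricop x) y = g x (ricop y)"
  by (metis metric_ricop ric_sym ricop_closed sym)

lemma ricop_scale: "x \<in> V \<Longrightarrow> ricop (c *\<^sub>R x) = c *\<^sub>R ricop x"
  by (rule eq_by_metric) (simp_all add: ricop_selfadjoint scale_left)

lemma ricop_funpow_closed [simp]: "x \<in> V \<Longrightarrow> (ricop ^^ l) x \<in> V"
  by (induction l) simp_all

lemma ricop_funpow_selfadjoint:
  "x \<in> V \<Longrightarrow> y \<in> V \<Longrightarrow> g ((ricop ^^ l) x) y = g x ((ricop ^^ l) y)"
proof (induction l arbitrary: x)
  case (Suc l)
  then show ?case by (simp add: ricop_selfadjoint funpow_swap1)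
qed simp

text \<open>
  This is \<open>Ta\<close> at a single point; \<open>r\<close> stands for the value of the scalar curvature there.
\<close>

definition T_tensor :: "(nat \<Rightarrow> real) \<Rightarrow> real \<Rightarrow> 'v \<Rightarrow> 'v \<Rightarrow> 'v \<Rightarrow> 'v" where
  "T_tensor a r x y z =
     a 0 *\<^sub>R R x y z + (a 1 * ric y z) *\<^sub>R x + (a 2 * ric x z) *\<^sub>R y + (a 3 * ric x y) *\<^sub>R z
     + (a 4 * g y z) *\<^sub>R ricop x + (a 5 * g x z) *\<^sub>R ricop y + (a 6 * g x y) *\<^sub>R ricop z
     + (a 7 * r) *\<^sub>R (g y z *\<^sub>R x - g x z *\<^sub>R y)"

end

section \<open>Vectors in the nullity space\<close>

locale nullity_curvature = algebraic_curvature V g R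
  for V :: "'v::real_vector set" and g R +
  fixes \<xi> :: 'v and k \<epsilon> :: real
  assumes \<xi>_in [simp]: "\<xi> \<in> V" and \<xi>_unit: "g \<xi> \<xi> = \<epsilon>"
    and nullity: "x \<in> V \<Longrightarrow> y \<in> V \<Longrightarrow> R x y \<xi> = k *\<^sub>R (g y \<xi> *\<^sub>R x - g x \<xi> *\<^sub>R y)"
begin

text \<open>
  The eigenvalue of the Ricci operator that belongs to the eigenvector \<open>\<xi>\<close>.
\<close>

abbreviation \<kappa> :: real where "\<kappa> \<equiv> k * (real (dim V) - 1)"

text \<open>
  With \<open>X \<and> Y\<close> formed by \<open>g\<close>, this says \<open>R(\<xi>, x) = k (\<xi> \<and> x)\<close>. It is the pair symmetric form
  of the nullity condition, and it is what makes \<open>R\<cdot>T\<close> and \<open>Q(S^l,T)\<close> comparable.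
\<close>

lemma R_\<xi>:
  assumes [simp]: "x \<in> V" "y \<in> V"
  shows "R \<xi> x y = k *\<^sub>R (g x y *\<^sub>R \<xi> - g \<xi> y *\<^sub>R x)"
proof (rule eq_by_metric)
  fix w assume [simp]: "w \<in> V"
  have "g (R \<xi> x y) w = g (R y w \<xi>) x" by (simp add: R_pair)
  also have "\<dots> = k * (g w \<xi> * g y x - g y \<xi> * g w x)"
    by (simp add: nullity bilinear)
  also have "\<dots> = g (k *\<^sub>R (g x y *\<^sub>R \<xi> - g \<xi> y *\<^sub>R x)) w"
    by (simp add: bilinear sym[of w \<xi>] sym[of y x] sym[of y \<xi>] sym[of w x])
  finally show "g (R \<xi> x y) w = g (k *\<^sub>R (g x y *\<^sub>R \<xi> - g \<xi> y *\<^sub>R x)) w" .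
qed simp_all

text \<open>
  Pairing with \<open>\<xi>\<close> exposes the nullity condition, because \<open>R x y\<close> is skew-adjoint.
\<close>

lemma R_normal:
  assumes [simp]: "x \<in> V" "y \<in> V" "z \<in> V"
  shows "g (R x y z) \<xi> = - k * (g y \<xi> * g x z - g x \<xi> * g y z)"
  using R_skew[of x y z \<xi>] by (simp add: nullity bilinear)

lemma ric_\<xi>:
  assumes [simp]: "y \<in> V"
  shows "ric y \<xi> = \<kappa> * g y \<xi>" "ric \<xi> y = \<kappa> * g y \<xi>"
proof -
  have "ric y \<xi> = trace_on V (\<lambda>x. (k * g y \<xi>) *\<^sub>R x + (- k) *\<^sub>R (g x \<xi> *\<^sub>R y))"
    unfolding ric_def by (rule trace_cong) (simp add: nullity algebra_simps)
  also have "\<dots> = k * g y \<xi> * dim V - k * g y \<xi>"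
    using trace_scale[of "\<lambda>x. x" "k * g y \<xi>"] trace_scale[of "\<lambda>x. g x \<xi> *\<^sub>R y" "- k"]
    by (subst trace_add) (simp_all add: trace_identity trace_rank_one linear_left del: scaleR_scaleR scaleR_minus_left)
  finally show "ric y \<xi> = \<kappa> * g y \<xi>" by (simp add: algebra_simps)
  then show "ric \<xi> y = \<kappa> * g y \<xi>" by (simp add: ric_sym[of \<xi> y])
qed

lemma ricop_\<xi>: "ricop \<xi> = \<kappa> *\<^sub>R \<xi>"
  by (rule eq_by_metric) (simp_all add: metric_ricop ric_\<xi> scale_left sym[of \<xi>])

lemma ricop_funpow_\<xi>: "(ricop ^^ l) \<xi> = \<kappa> ^ l *\<^sub>R \<xi>"
  by (induction l) (simp_all add: ricop_scale ricop_\<xi>)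

text \<open>
  This computation carries the theorem. Taking \<open>\<xi>\<close> for the first argument of \<open>T\<close> and for the first
  argument of the wedge product, and pairing the result with \<open>\<xi>\<close>, leaves only two kinds of values of
  \<open>T\<close>: the vector \<open>T(\<xi>, y)z\<close>, where \<open>R_\<xi>\<close> eliminates the curvature, and the number
  \<open>g(T(x, y)z, \<xi>)\<close>, where \<open>R_normal\<close> does. What remains is a polynomial in values of \<open>g\<close>, the Ricci
  tensor and its powers. The factor \<open>c\<close> is there since the lemma is applied to \<open>R(\<xi>, X)\<close>, which is
  \<open>k\<close> times the wedge product for the exponent \<open>0\<close>, as well as to the wedge product for the exponent \<open>l\<close>.
\<close>

lemma normal_component_wedge_action:
  fixes l :: nat and a :: "nat \<Rightarrow> real" and r c :: real and E :: "'v \<Rightarrow> 'v"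
  assumes [simp]: "X \<in> V" "Y \<in> V" "W \<in> V"
  defines "S \<equiv> \<lambda>m x y. g ((ricop ^^ m) x) y" and "\<eta> \<equiv> \<lambda>x. \<epsilon> * g x \<xi>"
  assumes E_wedge: "\<And>y. y \<in> V \<Longrightarrow> E y = c *\<^sub>R wedge (S l) \<xi> X y"
  shows "g (endo_act E (T_tensor a r) \<xi> Y W) \<xi> = c * (
       - (k * a 0 + \<kappa> * (a 1 + a 3 + a 4 + a 5 + a 6) + a 7 * r) * S l X Y * \<eta> W
       + \<kappa> ^ l * (k * a 0 + \<kappa> * (a 4 + a 6) + a 7 * r) * g X Y * \<eta> W
       + \<kappa> ^ (l + 1) * (a 4 + a 5) * g X W * \<eta> Y
       - \<kappa> * (a 1 + a 2 + a 4 + a 5 + a 6) * S l X W * \<eta> Y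
       + a 5 * S (l + 1) X Y * \<eta> W + a 6 * S (l + 1) X W * \<eta> Y
       + \<kappa> ^ l * (a 1 + a 3) * ric X Y * \<eta> W + \<kappa> ^ l * (a 1 + a 2) * ric X W * \<eta> Y)"
proof -
  define P where "P = (ricop ^^ l) X"
  have P [simp]: "P \<in> V" by (simp add: P_def)
  have S_l: "S l X y = g P y" for y by (simp add: S_def P_def)
  have P_ric: "g P (ricop y) = S (l + 1) X y" if "y \<in> V" for y
    using that by (simp add: S_def P_def ricop_selfadjoint[symmetric])
  have P_\<xi>: "g P \<xi> = \<kappa> ^ l * g X \<xi>"
    unfolding P_def by (simp add: ricop_funpow_selfadjoint ricop_funpow_\<xi> scale_right)
  have S_\<xi>: "S l \<xi> y = \<kappa> ^ l * g y \<xi>" if "y \<in> V" for y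
    using that by (simp add: S_def ricop_funpow_\<xi> scale_left sym[of \<xi>])
  have E: "E y = c *\<^sub>R (g P y *\<^sub>R \<xi> - (\<kappa> ^ l * g y \<xi>) *\<^sub>R X)" if "y \<in> V" for y
    using that by (simp add: E_wedge wedge_def S_l S_\<xi>)
  have E_in [simp]: "E y \<in> V" if "y \<in> V" for y using that by (simp add: E)
  have T_in: "T_tensor a r x y z \<in> V" if "x \<in> V" "y \<in> V" "z \<in> V" for x y z
    using that by (simp add: T_tensor_def)
  have T_\<xi>: "T_tensor a r \<xi> y z =
      (a 0 * k + a 7 * r) *\<^sub>R (g y z *\<^sub>R \<xi> - g z \<xi> *\<^sub>R y)
      + (a 1 * ric y z + a 4 * g y z * \<kappa>) *\<^sub>R \<xi> + (a 2 * \<kappa> * g z \<xi>) *\<^sub>R y + (a 3 * \<kappa> * g y \<xi>) *\<^sub>R z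
      + (a 5 * g z \<xi>) *\<^sub>R ricop y + (a 6 * g y \<xi>) *\<^sub>R ricop z" if "y \<in> V" "z \<in> V" for y z
    using that
    by (simp add: T_tensor_def R_\<xi> ric_\<xi> ricop_\<xi> sym[of \<xi>] algebra_simps)
  have T_normal: "g (T_tensor a r x y z) \<xi> =
      - (a 0 * k) * (g y \<xi> * g x z - g x \<xi> * g y z)
      + a 1 * ric y z * g x \<xi> + a 2 * ric x z * g y \<xi> + a 3 * ric x y * g z \<xi>
      + \<kappa> * (a 4 * g y z * g x \<xi> + a 5 * g x z * g y \<xi> + a 6 * g x y * g z \<xi>)
      + a 7 * r * (g y z * g x \<xi> - g x z * g y \<xi>)" if "x \<in> V" "y \<in> V" "z \<in> V" for x y z
    using that
    by (simp add: T_tensor_def bilinear R_normal metric_ricop ric_\<xi> algebra_simps)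
  have E_normal: "g (E y) \<xi> = c * (\<epsilon> * g P y - \<kappa> ^ l * g y \<xi> * g X \<xi>)" if "y \<in> V" for y
    using that by (simp add: E bilinear \<xi>_unit)
  have E_metric: "g (E y) z = c * (g P y * g z \<xi> - \<kappa> ^ l * g y \<xi> * g X z)"
    "g z (E y) = c * (g P y * g z \<xi> - \<kappa> ^ l * g y \<xi> * g X z)" if "y \<in> V" "z \<in> V" for y z
    using that by (simp_all add: E bilinear sym[of \<xi> z] sym[of z X])
  have E_ric': "ric z (E y) = c * (g P y * (\<kappa> * g z \<xi>) - \<kappa> ^ l * g y \<xi> * ric X z)" if "y \<in> V" "z \<in> V" for y z
    using that metric_ricop[of z "E y"] by (simp add: E bilinear metric_ricop ric_\<xi> ric_sym[of z X])
  have E_ric: "ric (E y) z = c * (g P y * (\<kappa> * g z \<xi>) - \<kappa> ^ l * g y \<xi> * ric X z)" if "y \<in> V" "z \<in> V" for y z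
    using that E_ric'[of y z] by (simp add: ric_sym[of "E y" z])
  have P_T: "g P (T_tensor a r \<xi> Y W) =
      (a 0 * k + a 7 * r) * (g Y W * (\<kappa> ^ l * g X \<xi>) - g W \<xi> * g P Y)
      + (a 1 * ric Y W + a 4 * g Y W * \<kappa>) * (\<kappa> ^ l * g X \<xi>)
      + a 2 * \<kappa> * g W \<xi> * g P Y + a 3 * \<kappa> * g Y \<xi> * g P W
      + a 5 * g W \<xi> * S (l + 1) X Y + a 6 * g Y \<xi> * S (l + 1) X W"
    by (simp add: T_\<xi> bilinear P_ric P_\<xi>)
  have "g (endo_act E (T_tensor a r) \<xi> Y W) \<xi> =
      g (E (T_tensor a r \<xi> Y W)) \<xi> - g (T_tensor a r (E \<xi>) Y W) \<xi>
      - g (T_tensor a r \<xi> (E Y) W) \<xi> - g (T_tensor a r \<xi> Y (E W)) \<xi>"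
    by (simp add: endo_act_def diff_left T_in)
  also have "\<dots> = c * (- (k * a 0 + \<kappa> * (a 1 + a 3 + a 4 + a 5 + a 6) + a 7 * r) * g P Y * \<eta> W
       + \<kappa> ^ l * (k * a 0 + \<kappa> * (a 4 + a 6) + a 7 * r) * g X Y * \<eta> W
       + \<kappa> * \<kappa> ^ l * (a 4 + a 5) * g X W * \<eta> Y
       - \<kappa> * (a 1 + a 2 + a 4 + a 5 + a 6) * g P W * \<eta> Y
       + a 5 * S (l + 1) X Y * \<eta> W + a 6 * S (l + 1) X W * \<eta> Y
       + \<kappa> ^ l * (a 1 + a 3) * ric X Y * \<eta> W + \<kappa> ^ l * (a 1 + a 2) * ric X W * \<eta> Y)"
  proof -
    \<comment> \<open>Naming the powers keeps the simplifier from multiplying out \<open>\<kappa> ^ l\<close>.\<close>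
    define q where "q = \<kappa> ^ l"
    define d where "d = \<kappa>"
    show ?thesis
      unfolding E_normal[OF T_in[OF \<xi>_in assms(2,3)]] P_T
      by (simp add: T_in T_normal E_metric E_ric E_ric' E_normal ric_\<xi> P_\<xi> \<xi>_unit sym[of \<xi>] \<eta>_def
          flip: q_def d_def) (simp add: algebra_simps)
  qed
  finally show ?thesis by (simp add: S_l)
qed

end

section \<open>Mixed partial derivatives and differentiability\<close>

lemma has_derivative_along_line:
  fixes f :: "'a::real_normed_vector \<Rightarrow> real"
  assumes "f differentiable (at (y + t *\<^sub>R u))"
  shows "((\<lambda>t. f (y + t *\<^sub>R u)) has_real_derivative frechet_derivative f (at (y + t *\<^sub>R u)) u) (at t)"
proof -
  let ?f' = "frechet_derivative f (at (y + t *\<^sub>R u))"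
  have f: "(f has_derivative ?f') (at (y + t *\<^sub>R u))"
    using assms by (simp add: frechet_derivative_works)
  have "((\<lambda>t. y + t *\<^sub>R u) has_derivative (\<lambda>s. s *\<^sub>R u)) (at t)"
    by (auto intro!: derivative_eq_intros)
  from diff_chain_at[OF this f] have "((\<lambda>t. f (y + t *\<^sub>R u)) has_derivative (\<lambda>s. ?f' (s *\<^sub>R u))) (at t)"
    by (simp add: o_def)
  moreover have "?f' (s *\<^sub>R u) = ?f' u * s" for s
    using linear_frechet_derivative[OF assms] by (simp add: linear_scale)
  ultimately show ?thesis by (simp add: has_field_derivative_def)
qed

text \<open>
  The mean value theorem, applied first in direction \<open>u\<close> and then in direction \<open>a\<close>.
\<close>

lemma second_difference_mean_value:
  fixes f :: "'a::real_normed_vector \<Rightarrow> real"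
  assumes h: "0 < h"
    and S: "\<And>s t. 0 \<le> s \<Longrightarrow> s \<le> h \<Longrightarrow> 0 \<le> t \<Longrightarrow> t \<le> h \<Longrightarrow> x + s *\<^sub>R a + t *\<^sub>R u \<in> S"
    and f: "\<And>y. y \<in> S \<Longrightarrow> f differentiable (at y)"
    and f': "\<And>y. y \<in> S \<Longrightarrow> (\<lambda>y. frechet_derivative f (at y) u) differentiable (at y)"
  obtains s t where "0 < s" "s < h" "0 < t" "t < h"
    "f (x + h *\<^sub>R a + h *\<^sub>R u) - f (x + h *\<^sub>R a) - f (x + h *\<^sub>R u) + f x
      = h * h * frechet_derivative (\<lambda>y. frechet_derivative f (at y) u) (at (x + s *\<^sub>R a + t *\<^sub>R u)) a"
proof -
  let ?D = "\<lambda>y. frechet_derivative f (at y) u"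
  have "((\<lambda>t. f (x + h *\<^sub>R a + t *\<^sub>R u) - f (x + t *\<^sub>R u)) has_real_derivative
      ?D (x + h *\<^sub>R a + t *\<^sub>R u) - ?D (x + t *\<^sub>R u)) (at t)" if "0 \<le> t" "t \<le> h" for t
    using that h S[of h t] S[of 0 t] by (intro DERIV_diff has_derivative_along_line f) auto
  from MVT2[OF h this] obtain t where t: "0 < t" "t < h"
    and first: "f (x + h *\<^sub>R a + h *\<^sub>R u) - f (x + h *\<^sub>R u) - (f (x + h *\<^sub>R a) - f x)
      = h * (?D (x + h *\<^sub>R a + t *\<^sub>R u) - ?D (x + t *\<^sub>R u))" by auto
  have "((\<lambda>s. ?D (x + t *\<^sub>R u + s *\<^sub>R a)) has_real_derivative
      frechet_derivative ?D (at (x + t *\<^sub>R u + s *\<^sub>R a)) a) (at s)" if "0 \<le> s" "s \<le> h" for s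
    using that t S[of s t] by (intro has_derivative_along_line f') (simp add: algebra_simps)
  from MVT2[OF h this] obtain s where s: "0 < s" "s < h"
    and second: "?D (x + t *\<^sub>R u + h *\<^sub>R a) - ?D (x + t *\<^sub>R u)
      = h * frechet_derivative ?D (at (x + t *\<^sub>R u + s *\<^sub>R a)) a" by auto
  have "f (x + h *\<^sub>R a + h *\<^sub>R u) - f (x + h *\<^sub>R a) - f (x + h *\<^sub>R u) + f x
      = h * h * frechet_derivative ?D (at (x + s *\<^sub>R a + t *\<^sub>R u)) a"
    using first second by (simp add: add_ac)
  with s t that show thesis by blast
qed

text \<open>
  The second difference is symmetric in the two directions. By the mean value theorem it is \<open>h\<^sup>2\<close> times
  either mixed derivative at points near \<open>x\<close>, and the mixed derivatives are continuous.
\<close>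

lemma mixed_partials_commute:
  fixes f :: "'a::real_normed_vector \<Rightarrow> real"
  assumes S: "open S" "x \<in> S" and f: "Ck_on (Suc (Suc 0)) S f"
  shows "frechet_derivative (\<lambda>y. frechet_derivative f (at y) u) (at x) a
    = frechet_derivative (\<lambda>y. frechet_derivative f (at y) a) (at x) u"
proof -
  define A where "A y = frechet_derivative (\<lambda>y. frechet_derivative f (at y) u) (at y) a" for y
  define B where "B y = frechet_derivative (\<lambda>y. frechet_derivative f (at y) a) (at y) u" for y
  have diff: "f differentiable (at y)" "(\<lambda>y. frechet_derivative f (at y) v) differentiable (at y)"
    if "y \<in> S" for y v
    using f that by simp_all
  have cont: "isCont A x" "isCont B x"
    using f S by (simp_all add: A_def[abs_def] B_def[abs_def] continuous_on_eq_continuous_at)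
  have bound: "\<bar>A x - B x\<bar> \<le> e + e" if e: "e > 0" for e
  proof -
    from cont e obtain d1 d2 where d12: "d1 > 0" "d2 > 0"
      "\<And>y. dist y x < d1 \<Longrightarrow> dist (A y) (A x) < e" "\<And>y. dist y x < d2 \<Longrightarrow> dist (B y) (B x) < e"
      unfolding continuous_at_eps_delta by metis
    obtain d3 where d3: "d3 > 0" "ball x d3 \<subseteq> S"
      using S open_contains_ball by blast
    define d where "d = min d1 (min d2 d3)"
    \<comment> \<open>With this step size the whole parallelogram lies in the ball of radius \<open>d\<close>.\<close>
    define h where "h = d / (2 * (norm a + norm u + 1))"
    have d: "d > 0" using d12 d3 by (simp add: d_def)
    have pos: "norm a + norm u + 1 > 0" by (smt (verit) norm_ge_zero)
    have h: "h > 0" using d pos by (simp add: h_def)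
    have near: "dist (x + s *\<^sub>R a + t *\<^sub>R u) x < d"
      if "0 \<le> s" "s \<le> h" "0 \<le> t" "t \<le> h" for s t
    proof -
      have "dist (x + s *\<^sub>R a + t *\<^sub>R u) x = norm (s *\<^sub>R a + t *\<^sub>R u)"
        by (simp add: dist_norm add.assoc)
      also have "\<dots> \<le> s * norm a + t * norm u"
        using that norm_triangle_ineq[of "s *\<^sub>R a" "t *\<^sub>R u"] by simp
      also have "\<dots> \<le> h * norm a + h * norm u"
        using that by (intro add_mono mult_right_mono) auto
      also have "\<dots> < h * (2 * (norm a + norm u + 1))"
        using h by (simp add: algebra_simps add_nonneg_pos)
      also have "\<dots> = d" using pos by (simp add: h_def)
      finally show ?thesis .
    qed
    have inS: "x + s *\<^sub>R a + t *\<^sub>R u \<in> S" if "0 \<le> s" "s \<le> h" "0 \<le> t" "t \<le> h" for s t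
      using near[OF that] d3 by (auto simp: d_def mem_ball dist_commute)
    have inS': "x + s *\<^sub>R u + t *\<^sub>R a \<in> S" if "0 \<le> s" "s \<le> h" "0 \<le> t" "t \<le> h" for s t
      using inS[of t s] that by (simp add: add_ac)
    obtain s t where st: "0 < s" "s < h" "0 < t" "t < h" and *:
      "f (x + h *\<^sub>R a + h *\<^sub>R u) - f (x + h *\<^sub>R a) - f (x + h *\<^sub>R u) + f x
        = h * h * A (x + s *\<^sub>R a + t *\<^sub>R u)"
      by (rule second_difference_mean_value[OF h inS diff(1) diff(2)[of _ u]]) (auto simp: A_def)
    obtain s' t' where st': "0 < s'" "s' < h" "0 < t'" "t' < h" and **:
      "f (x + h *\<^sub>R u + h *\<^sub>R a) - f (x + h *\<^sub>R u) - f (x + h *\<^sub>R a) + f x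
        = h * h * B (x + s' *\<^sub>R u + t' *\<^sub>R a)"
      by (rule second_difference_mean_value[OF h inS' diff(1) diff(2)[of _ a]]) (auto simp: B_def)
    have swap: "x + h *\<^sub>R u + h *\<^sub>R a = x + h *\<^sub>R a + h *\<^sub>R u" by (simp add: add_ac)
    have "h * h * A (x + s *\<^sub>R a + t *\<^sub>R u) = h * h * B (x + s' *\<^sub>R u + t' *\<^sub>R a)"
      using * ** unfolding swap by linarith
    then have "A (x + s *\<^sub>R a + t *\<^sub>R u) = B (x + t' *\<^sub>R a + s' *\<^sub>R u)"
      using h by (simp add: add_ac)
    moreover have "dist (A (x + s *\<^sub>R a + t *\<^sub>R u)) (A x) < e"
      using near[of s t] st by (intro d12) (simp add: d_def)
    moreover have "dist (B (x + t' *\<^sub>R a + s' *\<^sub>R u)) (B x) < e"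
      using near[of t' s'] st' by (intro d12) (simp add: d_def)
    ultimately show ?thesis by (simp add: dist_real_def)
  qed
  have "\<bar>A x - B x\<bar> \<le> 0"
  proof (rule field_le_epsilon)
    fix e :: real assume "0 < e"
    with bound[of "e / 2"] show "\<bar>A x - B x\<bar> \<le> 0 + e" by simp
  qed
  then show ?thesis by (simp add: A_def B_def)
qed

lemma differentiable_det:
  fixes M :: "'a::real_normed_vector \<Rightarrow> real ^ 'n ^ 'n"
  assumes "\<And>i j. (\<lambda>y. M y $ i $ j) differentiable (at x)"
  shows "(\<lambda>y. det (M y)) differentiable (at x)"
proof -
  have "\<exists>M'. \<forall>i j. ((\<lambda>y. M y $ i $ j) has_derivative M' i j) (at x)"
    using assms unfolding differentiable_def by metis
  then obtain M' where M': "\<And>i j. ((\<lambda>y. M y $ i $ j) has_derivative M' i j) (at x)" by blast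
  have "((\<lambda>y. \<Prod>i\<in>UNIV. M y $ i $ p i) has_derivative
      (\<lambda>z. \<Sum>i\<in>UNIV. M' i (p i) z * (\<Prod>j\<in>UNIV - {i}. M x $ j $ p j))) (at x)" for p
    by (rule has_derivative_prod) (rule M')
  then have "(\<lambda>y. \<Prod>i\<in>UNIV. M y $ i $ p i) differentiable (at x)" for p
    unfolding differentiable_def by blast
  then show ?thesis
    unfolding det_def by (intro differentiable_sum differentiable_mult) simp_all
qed

lemma differentiable_vec:
  fixes f :: "'a::euclidean_space \<Rightarrow> real ^ 'n"
  assumes "\<And>i. (\<lambda>y. f y $ i) differentiable (at x)"
  shows "f differentiable (at x)"
  using assms by (subst differentiable_componentwise_within) (auto simp: Basis_vec_def inner_axis)

lemma differentiable_eq_on_open: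
  assumes "open S" "x \<in> S" "\<And>y. y \<in> S \<Longrightarrow> f y = h y" "h differentiable (at x)"
  shows "f differentiable (at x)"
  using assms has_derivative_transform_within_open[of h _ x UNIV S f]
  unfolding differentiable_def by metis

section \<open>Tangent spaces\<close>

lemma comp_simps [simp]:
  "comp 0 c = 0" "comp (u + v) c = comp u c + comp v c" "comp (u - v) c = comp u c - comp v c"
  "comp (- v) c = - comp v c" "comp (t *\<^sub>R v) c = t *\<^sub>R comp v c"
  by (simp_all add: zero_tvec_def plus_tvec_def minus_tvec_def uminus_tvec_def scaleR_tvec_def
      TV_inverse)

lemma tvec_eqI: "(\<And>c. comp u c = comp v c) \<Longrightarrow> u = v"
  using comp_inject by blast

locale atlas =
  fixes A :: "('m::{t2_space,second_countable_topology}, 'n::finite) chart set"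
  assumes atlas: "smooth_atlas A"
begin

lemma chart_dom_open: "c \<in> A \<Longrightarrow> open (cdom c)"
  and chart_image_open: "c \<in> A \<Longrightarrow> open (coord c ` cdom c)"
  and chart_homeomorphism: "c \<in> A \<Longrightarrow> homeomorphism (cdom c) (coord c ` cdom c) (coord c) (cinv c)"
  using atlas by (auto simp: smooth_atlas_def)

lemma cinv_coord: "c \<in> A \<Longrightarrow> p \<in> cdom c \<Longrightarrow> cinv c (coord c p) = p"
  using chart_homeomorphism by (auto simp: homeomorphism_def)

lemma chart_at: "chart_at A p \<in> A" "p \<in> cdom (chart_at A p)"
proof -
  have "p \<in> (\<Union>c\<in>A. cdom c)" using atlas by (simp add: smooth_atlas_def)
  then have "\<exists>c. c \<in> A \<and> p \<in> cdom c" by blast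
  from someI_ex[OF this] show "chart_at A p \<in> A" "p \<in> cdom (chart_at A p)"
    by (simp_all add: chart_at_def)
qed

lemma overlap_open:
  assumes "c \<in> A" "d \<in> A"
  shows "open (coord c ` (cdom c \<inter> cdom d))"
proof -
  have "coord c ` (cdom c \<inter> cdom d) = coord c ` cdom c \<inter> cinv c -` cdom d"
    using cinv_coord[OF assms(1)] by auto
  moreover have "open (coord c ` cdom c \<inter> cinv c -` cdom d)"
    using chart_homeomorphism[OF assms(1)] chart_image_open[OF assms(1)] chart_dom_open[OF assms(2)]
    by (intro continuous_open_preimage) (auto simp: homeomorphism_def)
  ultimately show ?thesis by simp
qed

lemma transition_differentiable:
  assumes "c \<in> A" "d \<in> A" "p \<in> cdom c" "p \<in> cdom d"
  shows "(coord d \<circ> cinv c) differentiable (at (coord c p))"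
proof -
  have "Ck_on (Suc 0) (coord c ` (cdom c \<inter> cdom d)) (coord d \<circ> cinv c)"
    using atlas assms by (simp add: smooth_atlas_def smooth_on_def del: Ck_on.simps)
  with assms show ?thesis by simp
qed

lemma transition_linear:
  assumes "c \<in> A" "d \<in> A" "p \<in> cdom c" "p \<in> cdom d"
  shows "linear (frechet_derivative (coord d \<circ> cinv c) (at (coord c p)))"
  by (rule linear_frechet_derivative) (rule transition_differentiable[OF assms])

lemma transition_same:
  assumes "c \<in> A" "p \<in> cdom c"
  shows "frechet_derivative (coord c \<circ> cinv c) (at (coord c p)) u = u"
proof -
  have "frechet_derivative (coord c \<circ> cinv c) (at (coord c p)) = frechet_derivative (\<lambda>x. x) (at (coord c p))"
    using assms by (intro frechet_derivative_transform_within_open[OF transition_differentiable chart_image_open])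
      (auto simp: cinv_coord)
  then show ?thesis by simp
qed

text \<open>
  By the chain rule, the components of \<open>tv\<close> in different charts fit together.
\<close>

lemma transition_compose:
  assumes "c \<in> A" "d \<in> A" "e \<in> A" "p \<in> cdom c" "p \<in> cdom d" "p \<in> cdom e"
  shows "frechet_derivative (coord e \<circ> cinv d) (at (coord d p))
      (frechet_derivative (coord d \<circ> cinv c) (at (coord c p)) u)
    = frechet_derivative (coord e \<circ> cinv c) (at (coord c p)) u"
proof -
  let ?f = "coord d \<circ> cinv c" and ?h = "coord e \<circ> cinv d"
  have at_p: "?f (coord c p) = coord d p" using assms by (simp add: cinv_coord)
  have "frechet_derivative (coord e \<circ> cinv c) (at (coord c p)) = frechet_derivative (?h \<circ> ?f) (at (coord c p))"
    using assms by (intro frechet_derivative_transform_within_open[OF transition_differentiable overlap_open[of c d]])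
      (auto simp: cinv_coord)
  also have "\<dots> = frechet_derivative ?h (at (coord d p)) \<circ> frechet_derivative ?f (at (coord c p))"
    using transition_differentiable[of c d p] transition_differentiable[of d e p] assms
    by (subst frechet_derivative_compose) (simp_all add: at_p del: comp_apply)
  finally show ?thesis by simp
qed

lemma tv_linear:
  assumes "c \<in> A" "p \<in> cdom c"
  shows "linear (tv A c p)"
proof (rule linearI)
  note lin = linear_add[OF transition_linear] linear_scale[OF transition_linear]
  show "tv A c p (u + v) = tv A c p u + tv A c p v" for u v
    by (rule tvec_eqI) (simp add: tv_def TV_inverse assms lin)
  show "tv A c p (t *\<^sub>R v) = t *\<^sub>R tv A c p v" for t v
    by (rule tvec_eqI) (simp add: tv_def TV_inverse assms lin)
qed

lemma comp_tv: "c \<in> A \<Longrightarrow> p \<in> cdom c \<Longrightarrow> comp (tv A c p u) c = u"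
  by (simp add: tv_def TV_inverse transition_same)

lemma tv_in_tangent_space: "c \<in> A \<Longrightarrow> p \<in> cdom c \<Longrightarrow> tv A c p u \<in> tangent_space A p"
  by (auto simp: tangent_space_def tv_def TV_inverse transition_compose)

lemma tv_comp:
  assumes "c \<in> A" "p \<in> cdom c" "v \<in> tangent_space A p"
  shows "tv A c p (comp v c) = v"
proof (rule tvec_eqI)
  fix d
  show "comp (tv A c p (comp v c)) d = comp v d"
  proof (cases "d \<in> A \<and> p \<in> cdom d")
    case True
    then have "comp v d = frechet_derivative (coord d \<circ> cinv c) (at (coord c p)) (comp v c)"
      using assms unfolding tangent_space_def by blast
    with True show ?thesis unfolding tv_def by (simp add: TV_inverse)
  next
    case False
    then have "comp v d = 0" using assms(3) unfolding tangent_space_def by blast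
    with False show ?thesis unfolding tv_def by (auto simp: TV_inverse)
  qed
qed

lemma tangent_space_eq: "c \<in> A \<Longrightarrow> p \<in> cdom c \<Longrightarrow> tangent_space A p = range (tv A c p)"
  using tv_in_tangent_space[of c p] rangeI[of "tv A c p"] tv_comp[of c p] by (intro equalityI subsetI) (metis, blast)

lemma subspace_tangent_space: "subspace (tangent_space A p)"
proof -
  have "subspace (range (tv A (chart_at A p) p))"
    by (rule linear_subspace_image[OF tv_linear subspace_UNIV]) (rule chart_at)+
  then show ?thesis by (simp add: tangent_space_eq[of "chart_at A p"] chart_at)
qed

text \<open>
  The coordinate vectors of a chart form a basis.
\<close>

lemma dim_tangent_space: "dim (tangent_space A p) = CARD('n)"
  and tangent_space_finitely_generated: "\<exists>B. finite B \<and> span B = tangent_space A p"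
proof -
  let ?t = "tv A (chart_at A p) p"
  have lin: "linear ?t" by (rule tv_linear) (rule chart_at)+
  have inj: "inj ?t" using comp_tv[OF chart_at] by (metis injI)
  have span: "span (?t ` Basis) = tangent_space A p"
    by (simp add: linear_span_image[OF lin] tangent_space_eq[OF chart_at, symmetric])
  have "independent (?t ` Basis)"
    by (rule real_vector.linear_independent_injective_image[OF _ independent_Basis])
      (use lin inj in \<open>auto simp: linear_def inj_on_def\<close>)
  then have "dim (span (?t ` Basis)) = card (?t ` Basis)"
    by (rule real_vector.dim_span_eq_card_independent)
  also have "\<dots> = CARD('n)"
    using card_image[OF inj_on_subset[OF inj subset_UNIV], of Basis] by simp
  finally show "dim (tangent_space A p) = CARD('n)" by (simp add: span)
  from span show "\<exists>B. finite B \<and> span B = tangent_space A p" by (metis finite_Basis finite_imageI)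
qed

end

locale metric_manifold =
  fixes A :: "('m::{t2_space,second_countable_topology}, 'n::finite) chart set"
    and g :: "('m, 'n) tensor02"
  assumes metric: "semi_riemannian A g"
begin

sublocale atlas A
  using metric by unfold_locales (simp add: semi_riemannian_def)

sublocale tangent: scalar_product_space "tangent_space A p" "g p" for p
  using metric subspace_tangent_space tangent_space_finitely_generated
  by unfold_locales (auto simp: semi_riemannian_def)

end

section \<open>The Levi-Civita connection and its curvature in a chart\<close>

locale metric_chart = metric_manifold A g
  for A :: "('m::{t2_space,second_countable_topology}, 'n::finite) chart set" and g +
  fixes c :: "('m, 'n) chart"
  assumes chart: "c \<in> A"
begin

abbreviation D :: "(real ^ 'n) set" where "D \<equiv> coord c ` cdom c"
abbreviation G :: "real ^ 'n \<Rightarrow> real ^ 'n \<Rightarrow> real ^ 'n \<Rightarrow> real" where "G \<equiv> lmetric A g c"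
abbreviation \<Gamma> :: "real ^ 'n \<Rightarrow> real ^ 'n \<Rightarrow> real ^ 'n \<Rightarrow> real ^ 'n" where "\<Gamma> \<equiv> christoffel A g c"

definition dG :: "real ^ 'n \<Rightarrow> real ^ 'n \<Rightarrow> real ^ 'n \<Rightarrow> real ^ 'n \<Rightarrow> real" where
  "dG x u v w = frechet_derivative (\<lambda>y. G y v w) (at x) u"

lemma open_D: "open D"
  by (rule chart_image_open[OF chart])

lemma cinv_in: "x \<in> D \<Longrightarrow> cinv c x \<in> cdom c"
  using cinv_coord[OF chart] by auto

lemma G_smooth: "Ck_on j D (\<lambda>y. G y u v)"
  using metric chart by (simp add: semi_riemannian_def smooth_on_def)

lemma G_differentiable: "x \<in> D \<Longrightarrow> (\<lambda>y. G y u v) differentiable (at x)"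
  using G_smooth[of "Suc 0" u v] unfolding Ck_on.simps by blast

lemma dG_differentiable: "x \<in> D \<Longrightarrow> (\<lambda>y. dG y u v w) differentiable (at x)"
  using G_smooth[of "Suc (Suc 0)" v w] unfolding Ck_on.simps dG_def by blast

text \<open>
  The linear isomorphism between coordinate vectors and tangent vectors carries the properties of \<open>g\<close> over.
\<close>

lemma scalar_product_G:
  assumes "x \<in> D"
  shows "scalar_product_space UNIV (G x)"
proof -
  let ?p = "cinv c x"
  note p = cinv_in[OF assms]
  note tv_in [simp] = tv_in_tangent_space[OF chart p]
  note lin = tv_linear[OF chart p]
  show ?thesis
  proof
    show "\<exists>B. finite B \<and> span B = (UNIV :: (real ^ 'n) set)"
      by (intro exI[of _ Basis]) simp
    show "G x u v = G x v u" for u v by (simp add: lmetric_def tangent.sym)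
    show "G x (u + v) w = G x u w + G x v w" for u v w
      by (simp add: lmetric_def linear_add[OF lin] tangent.add_left)
    show "G x (t *\<^sub>R u) w = t * G x u w" for u w t
      by (simp add: lmetric_def linear_scale[OF lin] tangent.scale_left)
    fix u assume u: "\<And>v. v \<in> UNIV \<Longrightarrow> G x u v = 0"
    have "g ?p (tv A c ?p u) v = 0" if "v \<in> tangent_space A ?p" for v
      using u[of "comp v c"] by (simp add: lmetric_def tv_comp[OF chart p that])
    then have "tv A c ?p u = 0" using tangent.nondegenerate[OF tv_in] by simp
    then show "u = 0" using comp_tv[OF chart p, of u] by simp
  qed (rule subspace_UNIV)
qed

context
  fixes x assumes x: "x \<in> D"
begin

interpretation P: scalar_product_space UNIV "G x"
  by (rule scalar_product_G[OF x])

lemma G_sym: "G x u v = G x v u"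
  by (rule P.sym) simp_all

lemma G_bilinear:
  "G x (u + v) w = G x u w + G x v w" "G x w (u + v) = G x w u + G x w v"
  "G x (u - v) w = G x u w - G x v w" "G x w (u - v) = G x w u - G x w v"
  "G x (t *\<^sub>R u) w = t * G x u w" "G x w (t *\<^sub>R u) = t * G x w u"
  by (simp_all add: P.bilinear)

lemma G_eqI: "(\<And>w. G x u w = G x v w) \<Longrightarrow> u = v"
  by (rule P.eq_by_metric) simp_all

lemma G_riesz: "linear f \<Longrightarrow> \<exists>w. \<forall>z. G x w z = f z"
proof -
  assume "linear f"
  then have "linear_on_space UNIV f" by (auto intro!: linear_on_spaceI simp: linear_add linear_scale)
  then show ?thesis by (rule P.riesz) auto
qed

lemma G_expand: "G x u w = (\<Sum>i\<in>UNIV. u $ i * G x (axis i 1) w)"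
proof -
  have "linear_on_space UNIV (\<lambda>u. G x u w)" by (rule P.linear_left) simp
  from linear_on_space_sum[OF subspace_UNIV this, of UNIV "\<lambda>i. axis i 1" "\<lambda>i. u $ i"]
  show ?thesis by (simp add: basis_expansion[of u, unfolded scalar_mult_eq_scaleR])
qed

end

lemma dG_sym: "x \<in> D \<Longrightarrow> dG x u v w = dG x u w v"
  unfolding dG_def by (subst frechet_derivative_transform_within_open[OF G_differentiable open_D]) (auto intro: G_sym)

lemma dG_add1: "x \<in> D \<Longrightarrow> dG x (u + u') v w = dG x u v w + dG x u' v w"
  and dG_scale1: "x \<in> D \<Longrightarrow> dG x (t *\<^sub>R u) v w = t * dG x u v w"
  unfolding dG_def
  by (simp_all add: linear_add[OF linear_frechet_derivative[OF G_differentiable]]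
      linear_scale[OF linear_frechet_derivative[OF G_differentiable]])

text \<open>
  Expanding \<open>X\<close> in the standard basis reduces this to the product rule for real functions.
\<close>

lemma metric_product_rule:
  assumes x: "x \<in> D" and X: "X differentiable (at x)"
  shows "((\<lambda>y. G y (X y) w) has_derivative
    (\<lambda>a. G x (frechet_derivative X (at x) a) w + dG x a (X x) w)) (at x)"
proof -
  let ?X' = "frechet_derivative X (at x)"
  have X': "((\<lambda>y. X y $ i) has_derivative (\<lambda>a. ?X' a $ i)) (at x)" for i
    using bounded_linear.has_derivative[OF bounded_linear_vec_nth frechet_derivative_works[THEN iffD1, OF X]] .
  have G': "((\<lambda>y. G y v w) has_derivative (\<lambda>a. dG x a v w)) (at x)" for v
    using frechet_derivative_works[THEN iffD1, OF G_differentiable[OF x]] by (simp add: dG_def)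
  have dG_expand: "dG x a v w = (\<Sum>i\<in>UNIV. v $ i * dG x a (axis i 1) w)" for a v
  proof -
    have "((\<lambda>y. \<Sum>i\<in>UNIV. v $ i * G y (axis i 1) w) has_derivative
        (\<lambda>a. \<Sum>i\<in>UNIV. v $ i * dG x a (axis i 1) w)) (at x)"
      by (intro has_derivative_sum has_derivative_mult_right G')
    then have "((\<lambda>y. G y v w) has_derivative (\<lambda>a. \<Sum>i\<in>UNIV. v $ i * dG x a (axis i 1) w)) (at x)"
      by (rule has_derivative_transform_within_open[OF _ open_D x]) (simp add: G_expand)
    from has_derivative_unique[OF this G'] show ?thesis by metis
  qed
  have "((\<lambda>y. \<Sum>i\<in>UNIV. X y $ i * G y (axis i 1) w) has_derivative
      (\<lambda>a. \<Sum>i\<in>UNIV. X x $ i * dG x a (axis i 1) w + ?X' a $ i * G x (axis i 1) w)) (at x)"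
    by (intro has_derivative_sum has_derivative_mult G' X')
  then have "((\<lambda>y. G y (X y) w) has_derivative
      (\<lambda>a. \<Sum>i\<in>UNIV. X x $ i * dG x a (axis i 1) w + ?X' a $ i * G x (axis i 1) w)) (at x)"
    by (rule has_derivative_transform_within_open[OF _ open_D x]) (simp add: G_expand)
  moreover have "(\<Sum>i\<in>UNIV. X x $ i * dG x a (axis i 1) w + ?X' a $ i * G x (axis i 1) w)
      = G x (?X' a) w + dG x a (X x) w" for a
    by (simp add: sum.distrib G_expand[OF x, of "?X' a"] dG_expand[of a "X x"])
  ultimately show ?thesis by simp
qed

lemma dG_linear2: "x \<in> D \<Longrightarrow> linear (\<lambda>v. dG x a v w)"
proof (rule linearI)
  assume x: "x \<in> D"
  have G': "((\<lambda>y. G y v w) has_derivative (\<lambda>a. dG x a v w)) (at x)" for v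
    using frechet_derivative_works[THEN iffD1, OF G_differentiable[OF x]] by (simp add: dG_def)
  fix u v :: "real ^ 'n" and t :: real
  have "((\<lambda>y. G y (u + v) w) has_derivative (\<lambda>a. dG x a u w + dG x a v w)) (at x)"
    by (rule has_derivative_transform_within_open[OF has_derivative_add[OF G' G'] open_D x])
      (simp add: G_bilinear)
  from has_derivative_unique[OF G' this] show "dG x a (u + v) w = dG x a u w + dG x a v w" by metis
  have "((\<lambda>y. G y (t *\<^sub>R u) w) has_derivative (\<lambda>a. t * dG x a u w)) (at x)"
    by (rule has_derivative_transform_within_open[OF has_derivative_mult_right[OF G'] open_D x])
      (simp add: G_bilinear)
  from has_derivative_unique[OF G' this] show "dG x a (t *\<^sub>R u) w = t *\<^sub>R dG x a u w"
    by (metis real_scaleR_def)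
qed

lemma dG_linear3: "x \<in> D \<Longrightarrow> linear (\<lambda>w. dG x a v w)"
  using dG_linear2[of x a v] by (simp add: dG_sym[of x a v])

lemma dG_linear:
  assumes "x \<in> D"
  shows "dG x a (u + v) w = dG x a u w + dG x a v w" "dG x a w (u + v) = dG x a w u + dG x a w v"
    "dG x (u + v) w a = dG x u w a + dG x v w a"
    "dG x a (t *\<^sub>R u) w = t * dG x a u w" "dG x a w (t *\<^sub>R u) = t * dG x a w u"
    "dG x (t *\<^sub>R u) w a = t * dG x u w a"
  using assms
  by (simp_all add: linear_add[OF dG_linear2] linear_scale[OF dG_linear2] linear_add[OF dG_linear3]
      linear_scale[OF dG_linear3] dG_add1 dG_scale1)

text \<open>
  The right-hand side of the Koszul formula for coordinate fields, whose brackets vanish.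
\<close>

definition koszul :: "real ^ 'n \<Rightarrow> real ^ 'n \<Rightarrow> real ^ 'n \<Rightarrow> real ^ 'n \<Rightarrow> real" where
  "koszul x u v z = dG x u v z + dG x v u z - dG x z u v"

text \<open>
  The Riesz representation in the metric \<open>G x\<close> shows that the definite description in
  \<open>christoffel\<close> denotes something.
\<close>

lemma christoffel_koszul:
  assumes x: "x \<in> D"
  shows "2 * G x (\<Gamma> x u v) z = koszul x u v z"
proof -
  have "linear (\<lambda>z. koszul x u v z / 2)"
    by (rule linearI) (simp_all add: koszul_def dG_linear[OF x] field_simps)
  from G_riesz[OF x this] obtain w where w: "\<forall>z. 2 * G x w z = koszul x u v z" by (auto simp: mult.commute)
  have "\<exists>!w. \<forall>z. 2 * G x w z = koszul x u v z"
  proof (rule ex1I[of _ w])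
    fix w' assume "\<forall>z. 2 * G x w' z = koszul x u v z"
    with w have "2 * G x w' z = 2 * G x w z" for z by simp
    then show "w' = w" by (intro G_eqI[OF x]) simp
  qed (rule w)
  moreover have "\<Gamma> x u v = (THE w. \<forall>z. 2 * G x w z = koszul x u v z)"
    by (simp add: christoffel_def koszul_def dG_def)
  ultimately show ?thesis using theI'[of "\<lambda>w. \<forall>z. 2 * G x w z = koszul x u v z"] by simp
qed

lemma christoffel_eqI:
  assumes "x \<in> D" "\<And>z. koszul x u v z = 2 * G x w z"
  shows "\<Gamma> x u v = w"
proof (rule G_eqI[OF assms(1)])
  show "G x (\<Gamma> x u v) z = G x w z" for z
    using assms(2)[of z] christoffel_koszul[OF assms(1), of u v z] by simp
qed

text \<open>
  The connection has no torsion.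
\<close>

lemma christoffel_sym: "x \<in> D \<Longrightarrow> \<Gamma> x u v = \<Gamma> x v u"
  by (rule christoffel_eqI) (simp_all add: christoffel_koszul koszul_def dG_sym[of x _ u v])

lemma christoffel_linear2:
  assumes x: "x \<in> D"
  shows "linear (\<lambda>v. \<Gamma> x u v)"
proof (rule linearI)
  show "\<Gamma> x u (v + w) = \<Gamma> x u v + \<Gamma> x u w" for v w
    using x by (intro christoffel_eqI)
      (simp_all add: G_bilinear ring_distribs christoffel_koszul koszul_def dG_linear)
  show "\<Gamma> x u (t *\<^sub>R v) = t *\<^sub>R \<Gamma> x u v" for t v
  proof (rule christoffel_eqI[OF x])
    fix z
    have "2 * G x (t *\<^sub>R \<Gamma> x u v) z = t * (2 * G x (\<Gamma> x u v) z)" by (simp add: G_bilinear x)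
    then show "koszul x u (t *\<^sub>R v) z = 2 * G x (t *\<^sub>R \<Gamma> x u v) z"
      unfolding christoffel_koszul[OF x] by (simp add: koszul_def dG_linear x algebra_simps)
  qed
qed

lemma christoffel_linear1: "x \<in> D \<Longrightarrow> linear (\<lambda>u. \<Gamma> x u v)"
  using christoffel_linear2[of x v] by (simp add: christoffel_sym[of x v])

text \<open>
  Adding the Koszul formulas for \<open>\<Gamma>(u, v)\<close> and \<open>\<Gamma>(u, w)\<close> cancels all but the derivative along \<open>u\<close>.
\<close>

lemma metric_compatible: "x \<in> D \<Longrightarrow> dG x u v w = G x (\<Gamma> x u v) w + G x (\<Gamma> x u w) v"
  using christoffel_koszul[of x u v w] christoffel_koszul[of x u w v]
  by (simp add: koszul_def dG_sym[of x _ w v] dG_sym[of x _ w u] dG_sym[of x _ v u])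

text \<open>
  The Koszul formula is a linear system for \<open>\<Gamma>(u, v)\<close> whose matrix is the Gram matrix \<open>M\<close> of the
  metric. By Cramer's rule the solution is a quotient of determinants of differentiable functions.
\<close>

lemma christoffel_differentiable:
  assumes x: "x \<in> D"
  shows "(\<lambda>y. \<Gamma> y u v) differentiable (at x)"
proof -
  define M :: "real ^ 'n \<Rightarrow> real ^ 'n ^ 'n" where "M y = (\<chi> i j. G y (axis j 1) (axis i 1))" for y
  define b :: "real ^ 'n \<Rightarrow> real ^ 'n" where "b y = (\<chi> i. koszul y u v (axis i 1) / 2)" for y
  define N :: "'n \<Rightarrow> real ^ 'n \<Rightarrow> real ^ 'n ^ 'n" where
    "N k y = (\<chi> i j. if j = k then b y $ i else M y $ i $ j)" for k y
  have M_mult: "(M y *v w) $ i = G y w (axis i 1)" if "y \<in> D" for y w i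
    by (simp add: M_def matrix_vector_mult_def G_expand[OF that, of w] mult.commute)
  \<comment> \<open>A vector in the kernel of the Gram matrix is orthogonal to all vectors.\<close>
  have det: "det (M y) \<noteq> 0" if y: "y \<in> D" for y
  proof -
    have "w = 0" if "M y *v w = 0" for w
    proof (rule G_eqI[OF y])
      fix z
      have "G y w (axis i 1) = 0" for i using M_mult[OF y, of w i] that by simp
      then have "G y z w = 0" using y by (simp add: G_expand[OF y, of z] G_sym[OF y, of "axis _ 1" w])
      moreover have "G y 0 z = 0" using G_bilinear(5)[OF y, of 0 0 z] by simp
      ultimately show "G y w z = G y 0 z" by (simp add: G_sym[OF y, of w z])
    qed
    then show ?thesis
      by (simp add: invertible_det_nz[symmetric] invertible_left_inverse matrix_left_invertible_ker)
  qed
  have solution: "\<Gamma> y u v = (\<chi> k. det (N k y) / det (M y))" if y: "y \<in> D" for y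
  proof -
    have "M y *v \<Gamma> y u v = b y"
      using christoffel_koszul[OF y, of u v] by (simp add: vec_eq_iff M_mult[OF y] b_def mult.commute)
    then show ?thesis using cramer[OF det[OF y]] by (simp add: N_def)
  qed
  have M': "(\<lambda>y. M y $ i $ j) differentiable (at x)" for i j
    using G_differentiable[OF x] by (simp add: M_def)
  have b': "(\<lambda>y. b y $ i) differentiable (at x)" for i
    using dG_differentiable[OF x] by (simp add: b_def koszul_def)
  have N': "(\<lambda>y. N k y $ i $ j) differentiable (at x)" for k i j
    using M' b' by (cases "j = k") (simp_all add: N_def)
  have "(\<lambda>y. \<chi> k. det (N k y) / det (M y)) differentiable (at x)"
    by (rule differentiable_vec) (simp add: differentiable_det M' N' det[OF x])
  then show ?thesis
    by (rule differentiable_eq_on_open[OF open_D x solution, rotated])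
qed

definition d\<Gamma> :: "real ^ 'n \<Rightarrow> real ^ 'n \<Rightarrow> real ^ 'n \<Rightarrow> real ^ 'n \<Rightarrow> real ^ 'n" where
  "d\<Gamma> x a u v = frechet_derivative (\<lambda>y. \<Gamma> y u v) (at x) a"

lemma d\<Gamma>: "x \<in> D \<Longrightarrow> ((\<lambda>y. \<Gamma> y u v) has_derivative (\<lambda>a. d\<Gamma> x a u v)) (at x)"
  using frechet_derivative_works[THEN iffD1, OF christoffel_differentiable] by (simp add: d\<Gamma>_def)

lemma d\<Gamma>_sym: "x \<in> D \<Longrightarrow> d\<Gamma> x a u v = d\<Gamma> x a v u"
  unfolding d\<Gamma>_def by (subst frechet_derivative_transform_within_open[OF christoffel_differentiable open_D])
    (auto intro: christoffel_sym)

lemma d\<Gamma>_linear: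
  assumes x: "x \<in> D"
  shows "d\<Gamma> x (a + b) u v = d\<Gamma> x a u v + d\<Gamma> x b u v" "d\<Gamma> x (t *\<^sub>R a) u v = t *\<^sub>R d\<Gamma> x a u v"
    "d\<Gamma> x a (u + w) v = d\<Gamma> x a u v + d\<Gamma> x a w v" "d\<Gamma> x a (t *\<^sub>R u) v = t *\<^sub>R d\<Gamma> x a u v"
proof -
  show "d\<Gamma> x (a + b) u v = d\<Gamma> x a u v + d\<Gamma> x b u v" "d\<Gamma> x (t *\<^sub>R a) u v = t *\<^sub>R d\<Gamma> x a u v"
    using linear_frechet_derivative[OF christoffel_differentiable[OF x]]
    by (simp_all add: d\<Gamma>_def linear_add linear_scale)
  have "((\<lambda>y. \<Gamma> y (u + w) v) has_derivative (\<lambda>a. d\<Gamma> x a u v + d\<Gamma> x a w v)) (at x)"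
    by (rule has_derivative_transform_within_open[OF has_derivative_add[OF d\<Gamma> d\<Gamma>] open_D x])
      (simp_all add: x linear_add[OF christoffel_linear1])
  from has_derivative_unique[OF d\<Gamma>[OF x] this] show "d\<Gamma> x a (u + w) v = d\<Gamma> x a u v + d\<Gamma> x a w v"
    by metis
  have "((\<lambda>y. \<Gamma> y (t *\<^sub>R u) v) has_derivative (\<lambda>a. t *\<^sub>R d\<Gamma> x a u v)) (at x)"
    by (rule has_derivative_transform_within_open[OF has_derivative_scaleR_right[OF d\<Gamma>] open_D x])
      (simp_all add: x linear_scale[OF christoffel_linear1])
  from has_derivative_unique[OF d\<Gamma>[OF x] this] show "d\<Gamma> x a (t *\<^sub>R u) v = t *\<^sub>R d\<Gamma> x a u v"
    by metis
qed

text \<open>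
  The coordinate formula for the curvature of the connection \<open>\<Gamma>\<close>.
\<close>

definition K :: "real ^ 'n \<Rightarrow> real ^ 'n \<Rightarrow> real ^ 'n \<Rightarrow> real ^ 'n \<Rightarrow> real ^ 'n" where
  "K x u v w = d\<Gamma> x u v w - d\<Gamma> x v u w + \<Gamma> x u (\<Gamma> x v w) - \<Gamma> x v (\<Gamma> x u w)"

lemma lcurvature_eq:
  assumes x: "x \<in> D"
  shows "lcurvature A g c (\<lambda>_. u) (\<lambda>_. v) (\<lambda>_. w) x = K x u v w"
proof -
  have "\<Gamma> x 0 w = 0" using linear_0[OF christoffel_linear1[OF x]] .
  then show ?thesis
    by (simp add: lcurvature_def lnabla_def[abs_def] lbracket_def[abs_def] K_def d\<Gamma>_def)
qed

lemma K_swap: "K x v u w = - K x u v w"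
  by (simp add: K_def)

text \<open>
  Immediate from the symmetry of \<open>\<Gamma>\<close>: each term occurs twice, with opposite signs.
\<close>

lemma K_bianchi: "x \<in> D \<Longrightarrow> K x u v w + K x v w u + K x w u v = 0"
  by (simp add: K_def d\<Gamma>_sym[of x _ w v] d\<Gamma>_sym[of x _ w u] d\<Gamma>_sym[of x _ v u]
      christoffel_sym[of x w v] christoffel_sym[of x w u] christoffel_sym[of x v u])

lemma K_linear: "x \<in> D \<Longrightarrow> linear (\<lambda>u. K x u v w)"
  by (rule linearI)
    (simp_all add: K_def d\<Gamma>_linear linear_add[OF christoffel_linear1] linear_add[OF christoffel_linear2]
      linear_scale[OF christoffel_linear1] linear_scale[OF christoffel_linear2] algebra_simps)

text \<open>
  Differentiate the identity \<open>metric_compatible\<close> once more and antisymmetrise in the two directions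
  of differentiation. The second derivatives of the metric cancel since they commute. Applying
  \<open>metric_compatible\<close> to the remaining first derivatives produces the terms quadratic in \<open>\<Gamma>\<close>,
  and what is left is \<open>K\<close>.
\<close>

lemma K_skew:
  assumes x: "x \<in> D"
  shows "G x (K x a u v) w = - G x (K x a u w) v"
proof -
  have second: "frechet_derivative (\<lambda>y. dG y u v w) (at x) a =
      G x (d\<Gamma> x a u v) w + dG x a (\<Gamma> x u v) w + (G x (d\<Gamma> x a u w) v + dG x a (\<Gamma> x u w) v)" for a u
  proof -
    have "((\<lambda>y. G y (\<Gamma> y u v) w + G y (\<Gamma> y u w) v) has_derivative
      (\<lambda>a. G x (d\<Gamma> x a u v) w + dG x a (\<Gamma> x u v) w + (G x (d\<Gamma> x a u w) v + dG x a (\<Gamma> x u w) v))) (at x)"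
      unfolding d\<Gamma>_def by (intro has_derivative_add metric_product_rule christoffel_differentiable x)
    then have "((\<lambda>y. dG y u v w) has_derivative
      (\<lambda>a. G x (d\<Gamma> x a u v) w + dG x a (\<Gamma> x u v) w + (G x (d\<Gamma> x a u w) v + dG x a (\<Gamma> x u w) v))) (at x)"
      by (rule has_derivative_transform_within_open[OF _ open_D x]) (simp add: metric_compatible)
    then show ?thesis by (simp add: frechet_derivative_at[symmetric])
  qed
  have "frechet_derivative (\<lambda>y. dG y u v w) (at x) a = frechet_derivative (\<lambda>y. dG y a v w) (at x) u"
    unfolding dG_def by (rule mixed_partials_commute[OF open_D x G_smooth])
  then show ?thesis
    unfolding second by (simp add: metric_compatible[OF x] K_def G_bilinear[OF x] G_sym[OF x, of "\<Gamma> x a w"]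
        G_sym[OF x, of "\<Gamma> x a v" "\<Gamma> x u w"])
qed

end

section \<open>Pseudosymmetric manifolds\<close>

context metric_manifold
begin

text \<open>
  The Riemann tensor is the curvature \<open>K\<close> read in one chart, and passing from coordinate vectors to
  tangent vectors in that chart is a linear isometry. Hence the symmetries of \<open>K\<close> carry over.
\<close>

sublocale curvature: algebraic_curvature "tangent_space A p" "g p" "riemann A g p" for p
proof -
  interpret metric_chart A g "chart_at A p"
    by unfold_locales (rule chart_at)
  let ?c = "chart_at A p"
  let ?x = "coord ?c p"
  have x: "?x \<in> D" using chart_at by blast
  have p: "cinv ?c ?x = p" by (rule cinv_coord) (rule chart_at)+
  note c = chart_at[of p]
  have R: "riemann A g p u v w = tv A ?c p (K ?x (comp u ?c) (comp v ?c) (comp w ?c))" for u v w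
    by (simp add: riemann_def Let_def lcurvature_eq[OF x])
  have gG: "g p u v = G ?x (comp u ?c) (comp v ?c)" if "u \<in> tangent_space A p" "v \<in> tangent_space A p" for u v
    using that by (simp add: lmetric_def p tv_comp[OF c])
  note tv_lin = tv_linear[OF c]
  show "algebraic_curvature (tangent_space A p) (g p) (riemann A g p)"
  proof
    fix u v w assume uvw: "u \<in> tangent_space A p" "v \<in> tangent_space A p" "w \<in> tangent_space A p"
    show closed: "riemann A g p u v w \<in> tangent_space A p"
      unfolding R by (rule tv_in_tangent_space[OF c])
    show "riemann A g p v u w = - riemann A g p u v w"
      unfolding R by (subst K_swap) (simp add: linear_neg[OF tv_lin])
    show "riemann A g p u v w + riemann A g p v w u + riemann A g p w u v = 0"
      unfolding R linear_add[OF tv_lin, symmetric] by (simp add: K_bianchi[OF x] linear_0[OF tv_lin])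
    fix z assume z: "z \<in> tangent_space A p"
    show "g p (riemann A g p u v w) z = - g p (riemann A g p u v z) w"
      using uvw z K_skew[OF x, of "comp u ?c" "comp v ?c" "comp w ?c" "comp z ?c"] by (simp add: gG R tv_in_tangent_space[OF c] comp_tv[OF c])
  next
    fix v w assume "v \<in> tangent_space A p" "w \<in> tangent_space A p"
    show "linear_on_space (tangent_space A p) (\<lambda>u. riemann A g p u v w)"
      by (rule linear_on_spaceI)
        (simp_all add: R linear_add[OF K_linear[OF x]] linear_scale[OF K_linear[OF x]]
          linear_add[OF tv_lin] linear_scale[OF tv_lin])
  qed
qed

lemma ricci_eq: "ricci A g p = curvature.ric p"
  by (intro ext) (simp add: ricci_def curvature.ric_def)

lemma ricci_op_eq: "ricci_op A g p = curvature.ricop p"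
  by (intro ext) (simp add: ricci_op_def curvature.ricop_def ricci_eq)

lemma ricci_pow_eq: "ricci_pow A g l p x y = g p ((curvature.ricop p ^^ l) x) y"
  by (simp add: ricci_pow_def ricci_op_eq)

lemma Ta_eq: "Ta A g a p = curvature.T_tensor p a (scalar_curv A g p)"
  by (intro ext) (simp add: Ta_def curvature.T_tensor_def ricci_eq ricci_op_eq)

end

text \<open>
  The pseudosymmetry equation is used for \<open>U = Z = \<xi>\<close> only, paired with \<open>\<xi>\<close>.
\<close>

theorem theorem5p8:
  fixes A :: "('m::{t2_space,second_countable_topology}, 'n::finite) chart set"
    and g :: "('m, 'n) tensor02"
    and \<xi> :: "'m \<Rightarrow> ('m, 'n) tvec"
    and k \<epsilon> n :: real
    and a :: "nat \<Rightarrow> real"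
    and l :: nat
    and L :: "'m \<Rightarrow> real"
    and \<eta> :: "'m \<Rightarrow> ('m, 'n) tvec \<Rightarrow> real"
  defines "n \<equiv> real CARD('n)"
    and "\<eta> \<equiv> (\<lambda>p x. \<epsilon> * g p x (\<xi> p))"
  assumes "Nk_semi_riemannian A g k \<epsilon> \<xi>"
    and "pseudosymmetric A g a l L"
  shows "\<forall>p\<in>nonvanishing_set A g a l.
    \<forall>X\<in>tangent_space A p. \<forall>V\<in>tangent_space A p. \<forall>W\<in>tangent_space A p.
      k * (a 1 + a 3 + a 5) * (ricci A g p X V - k * (n - 1) * g p X V) * \<eta> p W
      + k * (a 1 + a 2 + a 6) * (ricci A g p X W - k * (n - 1) * g p X W) * \<eta> p V
      = L p *
        (- (k * a 0 + k * (n - 1) * (a 1 + a 3 + a 4 + a 5 + a 6) + a 7 * scalar_curv A g p)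
             * ricci_pow A g l p X V * \<eta> p W
         + k ^ l * (n - 1) ^ l * (k * a 0 + k * (n - 1) * (a 4 + a 6) + a 7 * scalar_curv A g p)
             * g p X V * \<eta> p W
         + k ^ (l + 1) * (n - 1) ^ (l + 1) * (a 4 + a 5) * g p X W * \<eta> p V
         - k * (n - 1) * (a 1 + a 2 + a 4 + a 5 + a 6) * ricci_pow A g l p X W * \<eta> p V
         + a 5 * ricci_pow A g (l + 1) p X V * \<eta> p W
         + a 6 * ricci_pow A g (l + 1) p X W * \<eta> p V
         + k ^ l * (n - 1) ^ l * (a 1 + a 3) * ricci A g p X V * \<eta> p W
         + k ^ l * (n - 1) ^ l * (a 1 + a 2) * ricci A g p X W * \<eta> p V)"
proof (intro ballI)
  interpret M: metric_manifold A g
    using assms(3) by unfold_locales (simp add: Nk_semi_riemannian_def)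
  fix p X V W
  assume p: "p \<in> nonvanishing_set A g a l"
    and X: "X \<in> tangent_space A p" and V: "V \<in> tangent_space A p" and W: "W \<in> tangent_space A p"
  interpret N: nullity_curvature "tangent_space A p" "g p" "riemann A g p" "\<xi> p" k \<epsilon>
    using assms(3) by unfold_locales (auto simp: Nk_semi_riemannian_def nullity_def)
  let ?T = "M.curvature.T_tensor p a (scalar_curv A g p)"
  have n: "real (dim (tangent_space A p)) = n"
    by (simp add: M.dim_tangent_space n_def)
  have left: "R_dot A g (Ta A g a) p (\<xi> p) V W (\<xi> p) X = endo_act (riemann A g p (\<xi> p) X) ?T (\<xi> p) V W"
    by (simp add: R_dot_def M.Ta_eq)
  have right: "Q_tachibana (ricci_pow A g l) (Ta A g a) p (\<xi> p) V W (\<xi> p) X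
      = endo_act (wedge (\<lambda>x. g p ((M.curvature.ricop p ^^ l) x)) (\<xi> p) X) ?T (\<xi> p) V W"
    by (simp add: Q_tachibana_def M.Ta_eq M.ricci_pow_eq[abs_def])
  have L: "endo_act (riemann A g p (\<xi> p) X) ?T (\<xi> p) V W
      = L p *\<^sub>R endo_act (wedge (\<lambda>x. g p ((M.curvature.ricop p ^^ l) x)) (\<xi> p) X) ?T (\<xi> p) V W"
    using assms(4) p X V W N.\<xi>_in unfolding pseudosymmetric_def left[symmetric] right[symmetric] by blast
  have T_in: "?T x y z \<in> tangent_space A p"
    if "x \<in> tangent_space A p" "y \<in> tangent_space A p" "z \<in> tangent_space A p" for x y z
    using that by (simp add: M.curvature.T_tensor_def)
  have wedge_in: "wedge (\<lambda>x. g p ((M.curvature.ricop p ^^ l) x)) (\<xi> p) X y \<in> tangent_space A p" for y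
    using X by (simp add: wedge_def)
  have "endo_act (wedge (\<lambda>x. g p ((M.curvature.ricop p ^^ l) x)) (\<xi> p) X) ?T (\<xi> p) V W \<in> tangent_space A p"
    unfolding endo_act_def using V W by (intro M.tangent.closed wedge_in T_in N.\<xi>_in)
  then have normal: "g p (endo_act (riemann A g p (\<xi> p) X) ?T (\<xi> p) V W) (\<xi> p) =
      L p * g p (endo_act (wedge (\<lambda>x. g p ((M.curvature.ricop p ^^ l) x)) (\<xi> p) X) ?T (\<xi> p) V W) (\<xi> p)"
    unfolding L by (simp add: M.tangent.scale_left)
  \<comment> \<open>For the exponent \<open>0\<close> the tensor \<open>S^l\<close> is the metric.\<close>
  have R_wedge: "riemann A g p (\<xi> p) X y = k *\<^sub>R wedge (\<lambda>x. g p ((M.curvature.ricop p ^^ 0) x)) (\<xi> p) X y"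
    if "y \<in> tangent_space A p" for y
    using X that by (simp add: N.R_\<xi> wedge_def)
  have one: "wedge (\<lambda>x. g p ((M.curvature.ricop p ^^ l) x)) (\<xi> p) X y = 1 *\<^sub>R wedge (\<lambda>x. g p ((M.curvature.ricop p ^^ l) x)) (\<xi> p) X y"
    for y by simp
  have ricop1: "g p (M.curvature.ricop p X) y = ricci A g p X y" if "y \<in> tangent_space A p" for y
    using X that by (simp add: M.curvature.metric_ricop M.ricci_eq)
  show "k * (a 1 + a 3 + a 5) * (ricci A g p X V - k * (n - 1) * g p X V) * \<eta> p W
      + k * (a 1 + a 2 + a 6) * (ricci A g p X W - k * (n - 1) * g p X W) * \<eta> p V
      = L p *
        (- (k * a 0 + k * (n - 1) * (a 1 + a 3 + a 4 + a 5 + a 6) + a 7 * scalar_curv A g p)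
             * ricci_pow A g l p X V * \<eta> p W
         + k ^ l * (n - 1) ^ l * (k * a 0 + k * (n - 1) * (a 4 + a 6) + a 7 * scalar_curv A g p)
             * g p X V * \<eta> p W
         + k ^ (l + 1) * (n - 1) ^ (l + 1) * (a 4 + a 5) * g p X W * \<eta> p V
         - k * (n - 1) * (a 1 + a 2 + a 4 + a 5 + a 6) * ricci_pow A g l p X W * \<eta> p V
         + a 5 * ricci_pow A g (l + 1) p X V * \<eta> p W
         + a 6 * ricci_pow A g (l + 1) p X W * \<eta> p V
         + k ^ l * (n - 1) ^ l * (a 1 + a 3) * ricci A g p X V * \<eta> p W
         + k ^ l * (n - 1) ^ l * (a 1 + a 2) * ricci A g p X W * \<eta> p V)" (is "?lhs = L p * ?rhs")
  proof -
    have "?lhs = g p (endo_act (riemann A g p (\<xi> p) X) ?T (\<xi> p) V W) (\<xi> p)"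
      by (subst N.normal_component_wedge_action[where c = k and l = 0, OF X V W R_wedge])
        (simp_all add: n \<eta>_def ricop1 V W M.ricci_eq algebra_simps)
    also have "\<dots> = L p * ?rhs"
      unfolding normal N.normal_component_wedge_action[OF X V W one] n \<eta>_def M.ricci_pow_eq M.ricci_eq
      by (simp add: power_mult_distrib)
    finally show ?thesis .
  qed
qed

end
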